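(* Let $\Phi$ be irreducible with highest root $\gamma$ and $\mathfrak h_\gamma=\Phi^+\setminus\{\gamma\}$. There exist $\mathbb R[\Delta]$-module homomorphisms (divided difference operators) $\partial^\gamma_i:H_T^*(\mathfrak h_\gamma)\to H_T^*(\mathfrak h_\gamma)$, $i=1,\dots,k$, and a family $\{\mathcal P^w\}_{w\in W}$ where each $\mathcal P^w$ is a flow-up class at $w$, such that for every $w\in W$ and every $i$, $$\partial^\gamma_i\mathcal P^w=\begin{cases}\mathcal P^{s_iw}&\text{if } s_iw<w,\\ 0&\text{if } s_iw>w.\end{cases}$$ Further, if $w=s_{i_1}\cdots s_{i_n}=s_{j_1}\cdots s_{j_n}$ are two reduced expressions for $w\in W$, then $\partial^\gamma_{i_1}\cdots\partial^\gamma_{i_n}=\partial^\gamma_{j_1}\cdots\partial^\gamma_{j_n}$; so $\partial_w:=\partial^\gamma_{i_1}\cdots\partial^\gamma_{i_n}$ is well defined.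
   Context: $\Phi$ is a crystallographic root system in a finite-dimensional real Euclidean space with base $\Delta=\{\alpha_1,\dots,\alpha_k\}$, positive roots $\Phi^+$, $\Phi^-=-\Phi^+$, Weyl group $W$ generated by the simple reflections $s_i=s_{\alpha_i}$ ($s_\alpha$ the reflection through $\alpha$), acting on $\mathbb R[\Delta]=\mathbb R[\alpha_1,\dots,\alpha_k]$. $\Phi$ irreducible means it is not a disjoint union of two root systems; then there is a unique highest root $\gamma\in\Phi^+$ with $\alpha\prec\gamma$ for all $\alpha\in\Phi$, where $\alpha\prec\beta$ means $\beta-\alpha$ is a sum of positive roots. Bruhat order $<$ on $W$ is the transitive closure of $u<s_\alpha u$ for $\alpha\in\Phi^+$ with $(s_\alpha u)^{-1}\alpha\in\Phi^-$. The Hessenberg graph $\Gamma_{\mathfrak h_\gamma}$ has vertex set $W$ and a directed edge $u\to w$ whenever $w=s_\alpha u$, $\alpha\in\Phi^+$, $w^{-1}\alpha\in-\mathfrak h_\gamma$. The GKM ring $H_T^*(\mathfrak h_\gamma)$ is the ring (and $\mathbb R[\Delta]$-module) of maps $\mathcal P:W\to\mathbb R[\Delta]$ with $\mathcal P(w)-\mathcal P(s_\alpha w)\in\langle\alpha\rangle$ for each edge of $\Gamma_{\mathfrak h_\gamma}$ joining $w$ and $s_\alpha w$; $\mathcal P\in H^d_T$ if every nonzero value is homogeneous of degree $d$. Write $x<_\gamma y$ if there is a directed path from $x$ to $y$ in $\Gamma_{\mathfrak h_\gamma}$, and let $\ell_\gamma(x)$ be the number of edges of $\Gamma_{\mathfrak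 h_\gamma}$ ending at $x$. A flow-up class at $x$ is $\mathcal P\in H_T^{\ell_\gamma(x)}(\mathfrak h_\gamma)$ with $\mathcal P(x)=\prod\alpha$ over the edges $s_\alpha x\to x$ of $\Gamma_{\mathfrak h_\gamma}$, and $\mathcal P(y)\neq0$ only if $y=x$ or $x<_\gamma y$. *)

theory Defs
  imports "HOL-Analysis.Analysis" "HOL-Library.Poly_Mapping"
begin

definition refl :: "'v::real_inner \<Rightarrow> 'v \<Rightarrow> 'v" where
  "refl \<alpha> x = x - ((2 * (x \<bullet> \<alpha>)) / (\<alpha> \<bullet> \<alpha>)) *\<^sub>R \<alpha>"

(* reduced crystallographic root system (not required to span) *)
definition root_system :: "'v::euclidean_space set \<Rightarrow> bool" where
  "root_system \<Phi> \<longleftrightarrow> finite \<Phi> \<and> 0 \<notin> \<Phi>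
     \<and> (\<forall>\<alpha>\<in>\<Phi>. refl \<alpha> ` \<Phi> = \<Phi>)
     \<and> (\<forall>\<alpha>\<in>\<Phi>. \<forall>\<beta>\<in>\<Phi>. (2 * (\<beta> \<bullet> \<alpha>)) / (\<alpha> \<bullet> \<alpha>) \<in> \<int>)
     \<and> (\<forall>\<alpha>\<in>\<Phi>. \<forall>c::real. c *\<^sub>R \<alpha> \<in> \<Phi> \<longrightarrow> c = 1 \<or> c = -1)"

definition irreducible_rs :: "'v::euclidean_space set \<Rightarrow> bool" where
  "irreducible_rs \<Phi> \<longleftrightarrow> \<Phi> \<noteq> {} \<and>
     \<not> (\<exists>A B. A \<noteq> {} \<and> B \<noteq> {} \<and> A \<union> B = \<Phi> \<and> A \<inter> B = {}
            \<and> (\<forall>a\<in>A. \<forall>b\<in>B. a \<bullet> b = 0))"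

(* the base \<Delta> = {alpha 0, ..., alpha (k-1)} (indices shifted to start at 0) *)
definition is_base :: "'v::euclidean_space set \<Rightarrow> (nat \<Rightarrow> 'v) \<Rightarrow> nat \<Rightarrow> bool" where
  "is_base \<Phi> alpha k \<longleftrightarrow> (\<forall>i<k. alpha i \<in> \<Phi>) \<and> inj_on alpha {..<k}
     \<and> independent (alpha ` {..<k})
     \<and> (\<forall>\<beta>\<in>\<Phi>. \<exists>c::nat \<Rightarrow> int. \<beta> = (\<Sum>i<k. of_int (c i) *\<^sub>R alpha i)
             \<and> ((\<forall>i<k. c i \<ge> 0) \<or> (\<forall>i<k. c i \<le> 0)))"

definition pos_roots :: "'v::euclidean_space set \<Rightarrow> (nat \<Rightarrow> 'v) \<Rightarrow> nat \<Rightarrow> 'v set" where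
  "pos_roots \<Phi> alpha k = {\<beta>\<in>\<Phi>. \<exists>c::nat \<Rightarrow> nat. \<beta> = (\<Sum>i<k. real (c i) *\<^sub>R alpha i)}"

definition prec_eq :: "'v::euclidean_space set \<Rightarrow> (nat \<Rightarrow> 'v) \<Rightarrow> nat \<Rightarrow> 'v \<Rightarrow> 'v \<Rightarrow> bool" where
  "prec_eq \<Phi> alpha k \<alpha> \<beta> \<longleftrightarrow> (\<exists>f::'v \<Rightarrow> nat.
      \<beta> - \<alpha> = (\<Sum>x\<in>pos_roots \<Phi> alpha k. real (f x) *\<^sub>R x))"

(* Weyl group: generated by the simple reflections (finite, so monoid closure suffices) *)
inductive_set weyl :: "(nat \<Rightarrow> 'v::real_inner) \<Rightarrow> nat \<Rightarrow> ('v \<Rightarrow> 'v) set"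
  for alpha k where
  weyl_id: "id \<in> weyl alpha k"
| weyl_step: "w \<in> weyl alpha k \<Longrightarrow> i < k \<Longrightarrow> refl (alpha i) \<circ> w \<in> weyl alpha k"

definition bruhat_step :: "'v::euclidean_space set \<Rightarrow> (nat \<Rightarrow> 'v) \<Rightarrow> nat
    \<Rightarrow> ('v \<Rightarrow> 'v) \<Rightarrow> ('v \<Rightarrow> 'v) \<Rightarrow> bool" where
  "bruhat_step \<Phi> alpha k u w \<longleftrightarrow> u \<in> weyl alpha k \<and>
     (\<exists>\<alpha>\<in>pos_roots \<Phi> alpha k. w = refl \<alpha> \<circ> u
        \<and> inv w \<alpha> \<in> uminus ` pos_roots \<Phi> alpha k)"

definition bruhat_less :: "'v::euclidean_space set \<Rightarrow> (nat \<Rightarrow> 'v) \<Rightarrow> nat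
    \<Rightarrow> ('v \<Rightarrow> 'v) \<Rightarrow> ('v \<Rightarrow> 'v) \<Rightarrow> bool" where
  "bruhat_less \<Phi> alpha k = (bruhat_step \<Phi> alpha k)\<^sup>+\<^sup>+"

definition word :: "(nat \<Rightarrow> 'v::real_inner) \<Rightarrow> nat list \<Rightarrow> 'v \<Rightarrow> 'v" where
  "word alpha is = foldr (\<lambda>i f. refl (alpha i) \<circ> f) is id"

definition reduced_expr :: "(nat \<Rightarrow> 'v::real_inner) \<Rightarrow> nat \<Rightarrow> nat list \<Rightarrow> ('v \<Rightarrow> 'v) \<Rightarrow> bool" where
  "reduced_expr alpha k is w \<longleftrightarrow> set is \<subseteq> {..<k} \<and> word alpha is = w \<and>
     (\<forall>js. set js \<subseteq> {..<k} \<and> word alpha js = w \<longrightarrow> length is \<le> length js)"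

type_synonym rpoly = "(nat \<Rightarrow>\<^sub>0 nat) \<Rightarrow>\<^sub>0 real"

definition in_RDelta :: "nat \<Rightarrow> rpoly \<Rightarrow> bool" where
  "in_RDelta k p \<longleftrightarrow> (\<forall>m\<in>Poly_Mapping.keys p. \<forall>j\<in>Poly_Mapping.keys m. j < k)"

definition mon_deg :: "(nat \<Rightarrow>\<^sub>0 nat) \<Rightarrow> nat" where
  "mon_deg m = (\<Sum>j\<in>Poly_Mapping.keys m. Poly_Mapping.lookup m j)"

definition homogeneous :: "nat \<Rightarrow> rpoly \<Rightarrow> bool" where
  "homogeneous d p \<longleftrightarrow> (\<forall>m\<in>Poly_Mapping.keys p. mon_deg m = d)"

definition var :: "nat \<Rightarrow> rpoly" where
  "var i = Poly_Mapping.single (Poly_Mapping.single i 1) 1"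

definition const :: "real \<Rightarrow> rpoly" where
  "const r = Poly_Mapping.single 0 r"

definition coords :: "(nat \<Rightarrow> 'v::real_vector) \<Rightarrow> nat \<Rightarrow> 'v \<Rightarrow> nat \<Rightarrow> real" where
  "coords alpha k v = (SOME c. v = (\<Sum>i<k. c i *\<^sub>R alpha i))"

definition lin :: "(nat \<Rightarrow> 'v::real_vector) \<Rightarrow> nat \<Rightarrow> 'v \<Rightarrow> rpoly" where
  "lin alpha k v = (\<Sum>i<k. const (coords alpha k v i) * var i)"

definition hedge :: "'v::euclidean_space set \<Rightarrow> (nat \<Rightarrow> 'v) \<Rightarrow> nat \<Rightarrow> 'v
    \<Rightarrow> ('v \<Rightarrow> 'v) \<Rightarrow> ('v \<Rightarrow> 'v) \<Rightarrow> 'v \<Rightarrow> bool" where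
  "hedge \<Phi> alpha k \<gamma> u w \<alpha> \<longleftrightarrow> u \<in> weyl alpha k \<and> \<alpha> \<in> pos_roots \<Phi> alpha k
     \<and> w = refl \<alpha> \<circ> u \<and> inv w \<alpha> \<in> uminus ` (pos_roots \<Phi> alpha k - {\<gamma>})"

definition hless :: "'v::euclidean_space set \<Rightarrow> (nat \<Rightarrow> 'v) \<Rightarrow> nat \<Rightarrow> 'v
    \<Rightarrow> ('v \<Rightarrow> 'v) \<Rightarrow> ('v \<Rightarrow> 'v) \<Rightarrow> bool" where
  "hless \<Phi> alpha k \<gamma> = (\<lambda>u w. \<exists>\<alpha>. hedge \<Phi> alpha k \<gamma> u w \<alpha>)\<^sup>+\<^sup>+"

definition hlen :: "'v::euclidean_space set \<Rightarrow> (nat \<Rightarrow> 'v) \<Rightarrow> nat \<Rightarrow> 'v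
    \<Rightarrow> ('v \<Rightarrow> 'v) \<Rightarrow> nat" where
  "hlen \<Phi> alpha k \<gamma> x = card {u. \<exists>\<alpha>. hedge \<Phi> alpha k \<gamma> u x \<alpha>}"

(* classes are maps W \<rightarrow> R[\<Delta>], extended by 0 outside W *)
definition GKM :: "'v::euclidean_space set \<Rightarrow> (nat \<Rightarrow> 'v) \<Rightarrow> nat \<Rightarrow> 'v
    \<Rightarrow> (('v \<Rightarrow> 'v) \<Rightarrow> rpoly) set" where
  "GKM \<Phi> alpha k \<gamma> = {P. (\<forall>w. w \<notin> weyl alpha k \<longrightarrow> P w = 0)
     \<and> (\<forall>w\<in>weyl alpha k. in_RDelta k (P w))
     \<and> (\<forall>u w \<alpha>. hedge \<Phi> alpha k \<gamma> u w \<alpha> \<longrightarrow>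
          (\<exists>q. in_RDelta k q \<and> P u - P w = lin alpha k \<alpha> * q))}"

definition GKM_deg :: "'v::euclidean_space set \<Rightarrow> (nat \<Rightarrow> 'v) \<Rightarrow> nat \<Rightarrow> 'v
    \<Rightarrow> nat \<Rightarrow> (('v \<Rightarrow> 'v) \<Rightarrow> rpoly) set" where
  "GKM_deg \<Phi> alpha k \<gamma> d = {P \<in> GKM \<Phi> alpha k \<gamma>.
     \<forall>w\<in>weyl alpha k. P w \<noteq> 0 \<longrightarrow> homogeneous d (P w)}"

definition flow_up :: "'v::euclidean_space set \<Rightarrow> (nat \<Rightarrow> 'v) \<Rightarrow> nat \<Rightarrow> 'v
    \<Rightarrow> ('v \<Rightarrow> 'v) \<Rightarrow> (('v \<Rightarrow> 'v) \<Rightarrow> rpoly) \<Rightarrow> bool" where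
  "flow_up \<Phi> alpha k \<gamma> x P \<longleftrightarrow> P \<in> GKM_deg \<Phi> alpha k \<gamma> (hlen \<Phi> alpha k \<gamma> x)
     \<and> P x = (\<Prod>\<alpha>\<in>{\<alpha>. hedge \<Phi> alpha k \<gamma> (refl \<alpha> \<circ> x) x \<alpha>}. lin alpha k \<alpha>)
     \<and> (\<forall>y\<in>weyl alpha k. P y \<noteq> 0 \<longrightarrow> y = x \<or> hless \<Phi> alpha k \<gamma> x y)"

definition module_hom :: "'v::euclidean_space set \<Rightarrow> (nat \<Rightarrow> 'v) \<Rightarrow> nat \<Rightarrow> 'v
    \<Rightarrow> ((('v \<Rightarrow> 'v) \<Rightarrow> rpoly) \<Rightarrow> (('v \<Rightarrow> 'v) \<Rightarrow> rpoly)) \<Rightarrow> bool" where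
  "module_hom \<Phi> alpha k \<gamma> D \<longleftrightarrow>
     (\<forall>P\<in>GKM \<Phi> alpha k \<gamma>. D P \<in> GKM \<Phi> alpha k \<gamma>)
   \<and> (\<forall>P\<in>GKM \<Phi> alpha k \<gamma>. \<forall>Q\<in>GKM \<Phi> alpha k \<gamma>. D (\<lambda>w. P w + Q w) = (\<lambda>w. D P w + D Q w))
   \<and> (\<forall>P\<in>GKM \<Phi> alpha k \<gamma>. \<forall>f. in_RDelta k f \<longrightarrow> D (\<lambda>w. f * P w) = (\<lambda>w. f * D P w))"

definition op_word :: "(nat \<Rightarrow> 'a \<Rightarrow> 'a) \<Rightarrow> nat list \<Rightarrow> 'a \<Rightarrow> 'a" where
  "op_word D is = foldr (\<lambda>i f. D i \<circ> f) is id"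

end

theory Submission
  imports Defs
begin

text \<open>The operators are defined by their values on a basis, so everything rests on the existence of
  flow-up classes: once there is one at every \<open>w\<close>, division by pairwise non-associated prime linear
  forms shows that they form a basis of the GKM ring, and the operators then satisfy the nil-Coxeter
  relations because \<open>s\<^sub>i\<close> changes the number of inversions by exactly one. Both the Bruhat graph and
  its subgraph without the \<open>\<gamma>\<close>-edges are treated at once.

  On the Bruhat graph flow-up classes are the equivariant Schubert classes \<open>P\<^sub>w\<close>, obtained from
  the top class by right divided differences \<open>(P(y s\<^sub>i) - P(y)) / y(\<alpha>\<^sub>i)\<close>. The highest root is
  dominant, so \<open>y \<gamma>\<close> decreases along Bruhat chains. If \<open>w \<gamma> < 0\<close>, then \<open>P\<^sub>w\<close> lives on \<open>{y. y \<gamma> < 0}\<close>;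
  hence it vanishes at \<open>y s\<^sub>\<gamma>\<close> whenever it does not vanish at \<open>y\<close>, its value at \<open>y\<close> is divisible
  by \<open>y \<gamma>\<close>, and the quotients \<open>P\<^sub>w(y) / (- y \<gamma>)\<close> form the flow-up class. If \<open>w \<gamma> > 0\<close>, then \<open>P\<^sub>w\<close> minus a
  multiple of the class at \<open>w s\<^sub>\<gamma>\<close> works. All support conditions follow from one degree argument:
  at a minimal bad point of the support the value is divisible by all incoming labels.\<close>

section \<open>Linear forms in the polynomial ring\<close>

abbreviation lookup where "lookup \<equiv> Poly_Mapping.lookup"
abbreviation keys where "keys \<equiv> Poly_Mapping.keys"
abbreviation single where "single \<equiv> Poly_Mapping.single"

lemma const_simps [simp]: "const 0 = 0" "const 1 = 1"
  by (simp_all add: const_def)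

lemma const_add: "const (a + b) = const a + const b"
  by (simp add: const_def single_add)

lemma const_diff: "const (a - b) = const a - const b"
  by (simp add: const_def single_diff)

lemma const_mult: "const (a * b) = const a * const b"
  by (simp add: const_def mult_single)

lemma poly_mapping_sum_single: "p = (\<Sum>m\<in>keys p. single m (lookup p m))"
proof (rule poly_mapping_eqI)
  fix n
  have "lookup (\<Sum>m\<in>keys p. single m (lookup p m)) n
      = (\<Sum>m\<in>keys p. if m = n then lookup p m else 0)"
    by (auto simp: lookup_sum lookup_single when_def intro!: sum.cong)
  also have "\<dots> = lookup p n" by (auto simp: sum.delta in_keys_iff)
  finally show "lookup p n = lookup (\<Sum>m\<in>keys p. single m (lookup p m)) n" by simp
qed

lemma poly_mapping_additive_induct:
  fixes p :: "'a \<Rightarrow>\<^sub>0 'b::comm_monoid_add"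
  assumes "\<And>m c. P (single m c)" and "P 0" and "\<And>p q. P p \<Longrightarrow> P q \<Longrightarrow> P (p + q)"
  shows "P p"
proof -
  have "P (\<Sum>m\<in>A. single m (lookup p m))" if "finite A" for A
    using that by induction (auto intro: assms)
  from this[of "keys p"] show ?thesis using poly_mapping_sum_single[of p] by simp
qed

section \<open>Evaluation homomorphisms of the polynomial ring\<close>

definition meval :: "(nat \<Rightarrow> rpoly) \<Rightarrow> (nat \<Rightarrow>\<^sub>0 nat) \<Rightarrow> rpoly" where
  "meval f m = (\<Prod>j\<in>keys m. f j ^ lookup m j)"

text \<open>The evaluation homomorphism over the reals that sends the variable with index
  \<open>i\<close> to \<open>f i\<close>.\<close>

definition psubst :: "(nat \<Rightarrow> rpoly) \<Rightarrow> rpoly \<Rightarrow> rpoly" where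
  "psubst f p = (\<Sum>m\<in>keys p. const (lookup p m) * meval f m)"

text \<open>Indices outside \<open>keys m\<close> have exponent 0, so two monomials can be evaluated
  over a common index set.\<close>

lemma meval_superset: "finite A \<Longrightarrow> keys m \<subseteq> A \<Longrightarrow> meval f m = (\<Prod>j\<in>A. f j ^ lookup m j)"
  unfolding meval_def by (rule prod.mono_neutral_left) (auto simp: in_keys_iff)

lemma meval_0 [simp]: "meval f 0 = 1" by (simp add: meval_def)

lemma meval_add: "meval f (m + n) = meval f m * meval f n"
proof -
  let ?A = "keys m \<union> keys n"
  have "meval f (m + n) = (\<Prod>j\<in>?A. f j ^ lookup (m + n) j)"
    using keys_add[of m n] by (intro meval_superset) auto
  also have "\<dots> = meval f m * meval f n"
    by (simp add: lookup_add power_add prod.distrib meval_superset[of ?A])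
  finally show ?thesis .
qed

lemma psubst_superset:
  "finite A \<Longrightarrow> keys p \<subseteq> A \<Longrightarrow> psubst f p = (\<Sum>m\<in>A. const (lookup p m) * meval f m)"
  unfolding psubst_def by (rule sum.mono_neutral_left) (auto simp: in_keys_iff)

lemma psubst_0 [simp]: "psubst f 0 = 0" by (simp add: psubst_def)

lemma psubst_add: "psubst f (p + q) = psubst f p + psubst f q"
proof -
  let ?A = "keys p \<union> keys q"
  have "psubst f (p + q) = (\<Sum>m\<in>?A. const (lookup (p + q) m) * meval f m)"
    using keys_add[of p q] by (intro psubst_superset) auto
  also have "\<dots> = psubst f p + psubst f q"
    by (simp add: lookup_add const_add distrib_right sum.distrib psubst_superset[of ?A])
  finally show ?thesis .
qed

lemma psubst_sum: "psubst f (\<Sum>i\<in>A. g i) = (\<Sum>i\<in>A. psubst f (g i))"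
  by (induction A rule: infinite_finite_induct) (auto simp: psubst_add)

lemma psubst_single: "psubst f (single m c) = const c * meval f m"
  by (cases "c = 0") (auto simp: psubst_def)

lemma psubst_const [simp]: "psubst f (const c) = const c"
  by (simp add: const_def psubst_single[of f 0 c, unfolded const_def])

lemma psubst_var [simp]: "psubst f (var i) = f i"
  by (simp add: var_def psubst_single meval_def)

lemma psubst_mult: "psubst f (p * q) = psubst f p * psubst f q"
proof (induction p rule: poly_mapping_additive_induct)
  case (1 m c)
  show ?case
  proof (induction q rule: poly_mapping_additive_induct)
    case (1 n d)
    show ?case by (simp add: mult_single psubst_single meval_add const_mult ac_simps)
  qed (auto simp: psubst_add distrib_left)
qed (auto simp: psubst_add distrib_right)

lemma single_eq_meval: "single m 1 = meval var m"
proof (induction m rule: poly_mapping_additive_induct)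
  case (1 i n)
  have "single (single i n) 1 = var i ^ n"
  proof (induction n)
    case (Suc n)
    have "single (single i (Suc n)) 1 = var i * single (single i n) 1"
      by (simp add: var_def mult_single flip: single_add)
    then show ?case using Suc by simp
  qed simp
  then show ?case by (cases "n = 0") (auto simp: meval_def)
next
  case (3 p q)
  then show ?case by (metis meval_add mult_single mult_1)
qed simp

lemma psubst_var_id: "psubst var p = p"
proof (induction p rule: poly_mapping_additive_induct)
  case (1 m c)
  have "const c * single m 1 = single m c" by (simp add: const_def mult_single)
  then show ?case by (simp add: psubst_single single_eq_meval)
qed (auto simp: psubst_add)

lemma dvd_mult_diff:
  fixes d :: "'a::comm_ring_1"
  assumes "d dvd a - b" "d dvd x - y"
  shows "d dvd a * x - b * y"
proof -
  have "a * x - b * y = (a - b) * x + b * (x - y)" by (simp add: algebra_simps)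
  then show ?thesis using assms by simp
qed

text \<open>Congruences modulo \<open>d\<close> pass through sums and products, hence through
  powers, monomials and polynomials.\<close>

lemma dvd_psubst_diff:
  assumes "\<And>i. d dvd f i - g i"
  shows "d dvd psubst f p - psubst g p"
proof -
  have pw: "d dvd f i ^ n - g i ^ n" for i n
    by (induction n) (auto intro!: dvd_mult_diff assms)
  have pr: "d dvd (\<Prod>j\<in>A. f j ^ e j) - (\<Prod>j\<in>A. g j ^ e j)" for A e
    by (induction A rule: infinite_finite_induct) (auto intro!: dvd_mult_diff pw)
  show ?thesis
  proof (induction p rule: poly_mapping_additive_induct)
    case (1 m c)
    show ?case using pr by (auto simp: psubst_single meval_def simp flip: right_diff_distrib)
  next
    case (3 p q)
    have "psubst f (p + q) - psubst g (p + q) = (psubst f p - psubst g p) + (psubst f q - psubst g q)"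
      by (simp add: psubst_add)
    then show ?case using 3 by (metis dvd_add)
  qed simp
qed

text \<open>The subring is the fixed set of the endomorphism that kills every variable of index at
  least \<open>k\<close>. Its closure properties then come from the homomorphism laws.\<close>

lemma in_RDelta_iff_psubst: "in_RDelta k p \<longleftrightarrow> psubst (\<lambda>i. if i < k then var i else 0) p = p"
    (is "?L \<longleftrightarrow> psubst ?f p = p")
proof
  assume ?L
  have "psubst ?f p = psubst var p"
    unfolding psubst_def meval_def
    by (intro sum.cong refl arg_cong[where f="(*) (const _)"] prod.cong)
       (use \<open>?L\<close> in \<open>auto simp: in_RDelta_def\<close>)
  then show "psubst ?f p = p" by (simp add: psubst_var_id)
next
  assume eq: "psubst ?f p = p"
  \<comment> \<open>A term containing a killed variable is sent to 0 and every other term is fixed,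
    so no forbidden monomial occurs in an image.\<close>
  have z: "lookup (psubst ?f p) m = 0" if "j \<in> keys m" "j \<ge> k" for m j
  proof (induction p rule: poly_mapping_additive_induct)
    case (1 n c)
    show ?case
    proof (cases "\<exists>i\<in>keys n. i \<ge> k")
      case True
      then obtain i where "i \<in> keys n" "i \<ge> k" by blast
      then have "meval ?f n = 0"
        unfolding meval_def by (intro prod_zero) (auto simp: in_keys_iff intro!: bexI[of _ i])
      then show ?thesis by (simp add: psubst_single)
    next
      case False
      then have "meval ?f n = meval var n" unfolding meval_def by (intro prod.cong) auto
      then have "psubst ?f (single n c) = single n c"
        by (simp add: psubst_single const_def mult_single flip: single_eq_meval)
      moreover have "m \<noteq> n" using False that by auto
      ultimately show ?thesis by (simp add: lookup_single)
    qed
  qed (auto simp: psubst_add lookup_add)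
  show ?L unfolding in_RDelta_def using eq z by (metis in_keys_iff not_le)
qed

lemma in_RDelta_0 [simp]: "in_RDelta k 0" by (simp add: in_RDelta_def)

lemma in_RDelta_add: "in_RDelta k p \<Longrightarrow> in_RDelta k q \<Longrightarrow> in_RDelta k (p + q)"
  by (simp add: in_RDelta_iff_psubst psubst_add)

lemma in_RDelta_mult: "in_RDelta k p \<Longrightarrow> in_RDelta k q \<Longrightarrow> in_RDelta k (p * q)"
  by (simp add: in_RDelta_iff_psubst psubst_mult)

lemma in_RDelta_const [simp]: "in_RDelta k (const c)"
  by (simp add: in_RDelta_iff_psubst)

lemma in_RDelta_minus: "in_RDelta k p \<Longrightarrow> in_RDelta k (- p)"
proof -
  have "const (- 1) * p = - p" by (simp add: const_def single_uminus)
  then show "in_RDelta k p \<Longrightarrow> ?thesis" using in_RDelta_mult[OF in_RDelta_const] by metis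
qed

lemma in_RDelta_diff: "in_RDelta k p \<Longrightarrow> in_RDelta k q \<Longrightarrow> in_RDelta k (p - q)"
  using in_RDelta_add[OF _ in_RDelta_minus, of k p q] by simp

lemma in_RDelta_var: "i < k \<Longrightarrow> in_RDelta k (var i)"
  by (simp add: in_RDelta_iff_psubst)

lemma in_RDelta_sum: "(\<And>i. i \<in> A \<Longrightarrow> in_RDelta k (f i)) \<Longrightarrow> in_RDelta k (\<Sum>i\<in>A. f i)"
  by (simp add: in_RDelta_iff_psubst psubst_sum)

lemma in_RDelta_prod: "(\<And>i. i \<in> A \<Longrightarrow> in_RDelta k (f i)) \<Longrightarrow> in_RDelta k (\<Prod>i\<in>A. f i)"
  using in_RDelta_const[of k 1]
  by (induction A rule: infinite_finite_induct) (auto intro: in_RDelta_mult)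

text \<open>The endomorphism fixes \<open>a\<close> and \<open>a * q\<close>; cancelling
  \<open>a\<close> shows that it fixes \<open>q\<close>.\<close>

lemma in_RDelta_cancel:
  assumes "in_RDelta k a" "a \<noteq> 0" "in_RDelta k (a * q)"
  shows "in_RDelta k q"
  using assms by (auto simp: in_RDelta_iff_psubst psubst_mult)

section \<open>Homogeneous components and degrees\<close>

definition hcomp :: "nat \<Rightarrow> rpoly \<Rightarrow> rpoly" where
  "hcomp d p = (\<Sum>m\<in>{m \<in> keys p. mon_deg m = d}. single m (lookup p m))"

lemma lookup_hcomp: "lookup (hcomp d p) n = (lookup p n when mon_deg n = d)"
proof -
  have "lookup (hcomp d p) n = (\<Sum>m\<in>{m \<in> keys p. mon_deg m = d}. if m = n then lookup p m else 0)"
    unfolding hcomp_def lookup_sum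
    by (intro sum.cong refl) (auto simp: lookup_single when_def)
  also have "\<dots> = (lookup p n when mon_deg n = d)"
    by (auto simp: sum.delta in_keys_iff when_def)
  finally show ?thesis .
qed

lemma hcomp_add: "hcomp d (p + q) = hcomp d p + hcomp d q"
  by (rule poly_mapping_eqI) (simp add: lookup_hcomp lookup_add when_add_distrib)

lemma hcomp_0 [simp]: "hcomp d 0 = 0"
  by (simp add: hcomp_def)

lemma homogeneous_iff_hcomp: "homogeneous d p \<longleftrightarrow> (\<forall>e. e \<noteq> d \<longrightarrow> hcomp e p = 0)"
proof
  assume "homogeneous d p"
  then show "\<forall>e. e \<noteq> d \<longrightarrow> hcomp e p = 0"
    by (auto simp: homogeneous_def hcomp_def intro!: sum.neutral)
next
  assume *: "\<forall>e. e \<noteq> d \<longrightarrow> hcomp e p = 0"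
  show "homogeneous d p" unfolding homogeneous_def
  proof (rule ballI, rule ccontr)
    fix m assume "m \<in> keys p" "mon_deg m \<noteq> d"
    then have "lookup (hcomp (mon_deg m) p) m = 0" using * by simp
    with \<open>m \<in> keys p\<close> show False by (simp add: lookup_hcomp in_keys_iff)
  qed
qed

lemma mon_deg_add: "mon_deg (m + n) = mon_deg m + mon_deg n"
proof -
  have *: "mon_deg m = (\<Sum>j\<in>A. lookup m j)" if "finite A" "keys m \<subseteq> A" for A m
    unfolding mon_deg_def using that by (intro sum.mono_neutral_left) (auto simp: in_keys_iff)
  let ?A = "keys m \<union> keys n"
  show ?thesis using keys_add[of m n]
    by (simp add: *[of ?A] lookup_add sum.distrib)
qed

lemma hcomp_single: "hcomp d (single m c) = (if mon_deg m = d then single m c else 0)"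
  by (rule poly_mapping_eqI) (auto simp: lookup_hcomp lookup_single when_def)

text \<open>Multiplication by a form of degree \<open>a\<close> shifts the grading by
  \<open>a\<close>; below degree \<open>a\<close> the product has no component, a case that
  truncated subtraction would miss.\<close>

lemma hcomp_mult:
  assumes "homogeneous a p"
  shows "hcomp d (p * q) = (if a \<le> d then p * hcomp (d - a) q else 0)"
proof -
  have 1: "hcomp d (single m c * q) = (if a \<le> d then single m c * hcomp (d - a) q else 0)"
    if "mon_deg m = a" for m c
  proof (induction q rule: poly_mapping_additive_induct)
    case (1 n e)
    show ?case using that by (auto simp: mult_single hcomp_single mon_deg_add)
  qed (auto simp: hcomp_add distrib_left)
  have "hcomp d (sum f A) = (\<Sum>m\<in>A. hcomp d (f m))" for f :: "_ \<Rightarrow> rpoly" and A :: "(nat \<Rightarrow>\<^sub>0 nat) set"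
    by (induction A rule: infinite_finite_induct) (auto simp: hcomp_add)
  then have "hcomp d ((\<Sum>m\<in>keys p. single m (lookup p m)) * q)
      = (\<Sum>m\<in>keys p. hcomp d (single m (lookup p m) * q))"
    by (simp add: sum_distrib_right)
  also have "\<dots> = (\<Sum>m\<in>keys p. if a \<le> d then single m (lookup p m) * hcomp (d - a) q else 0)"
    using assms by (intro sum.cong refl 1) (auto simp: homogeneous_def)
  also have "\<dots> = (if a \<le> d then (\<Sum>m\<in>keys p. single m (lookup p m)) * hcomp (d - a) q else 0)"
    by (auto simp: sum_distrib_right)
  finally show ?thesis by (simp flip: poly_mapping_sum_single)
qed

lemma homogeneous_0 [simp]: "homogeneous d 0" by (simp add: homogeneous_def)

lemma homogeneous_add: "homogeneous d p \<Longrightarrow> homogeneous d q \<Longrightarrow> homogeneous d (p + q)"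
  by (simp add: homogeneous_iff_hcomp hcomp_add)

lemma homogeneous_uminus: "homogeneous d p \<Longrightarrow> homogeneous d (- p)"
  by (simp add: homogeneous_def)

lemma homogeneous_diff: "homogeneous d p \<Longrightarrow> homogeneous d q \<Longrightarrow> homogeneous d (p - q)"
  using homogeneous_add[OF _ homogeneous_uminus, of d p q] by simp

lemma homogeneous_sum: "(\<And>i. i \<in> A \<Longrightarrow> homogeneous d (f i)) \<Longrightarrow> homogeneous d (\<Sum>i\<in>A. f i)"
  by (induction A rule: infinite_finite_induct) (auto intro: homogeneous_add)

lemma homogeneous_mult: "homogeneous a p \<Longrightarrow> homogeneous b q \<Longrightarrow> homogeneous (a + b) (p * q)"
  by (auto simp: homogeneous_iff_hcomp[of "a + b"] homogeneous_iff_hcomp[of b] hcomp_mult)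

lemma homogeneous_const: "homogeneous 0 (const c)"
  by (auto simp: homogeneous_def const_def mon_deg_def)

lemma homogeneous_prod:
  "finite A \<Longrightarrow> (\<And>i. i \<in> A \<Longrightarrow> homogeneous 1 (f i)) \<Longrightarrow> homogeneous (card A) (\<Prod>i\<in>A. f i)"
proof (induction A rule: finite_induct)
  case empty
  show ?case using homogeneous_const[of 1] by simp
next
  case (insert x A)
  then show ?case using homogeneous_mult[of 1 "f x" "card A"] by simp
qed

text \<open>Every component of \<open>q\<close> of degree other than \<open>b\<close> is annihilated
  by the nonzero form \<open>p\<close>, hence zero in a domain.\<close>

lemma homogeneous_cancel:
  assumes "homogeneous a p" "p \<noteq> 0" "homogeneous (a + b) (p * q)"
  shows "homogeneous b q"
  unfolding homogeneous_iff_hcomp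
proof (intro allI impI)
  fix e assume "e \<noteq> b"
  then have "hcomp (a + e) (p * q) = 0" using assms(3) by (auto simp: homogeneous_iff_hcomp)
  then show "hcomp e q = 0" using assms by (simp add: hcomp_mult)
qed

text \<open>The degree bound behind the support conditions: a multiple of a form of degree
  \<open>a\<close> has no component below degree \<open>a\<close>.\<close>

lemma homogeneous_dvd_le:
  assumes "homogeneous a p" "homogeneous d r" "p dvd r" "r \<noteq> 0"
  shows "a \<le> d"
proof (rule ccontr)
  assume "\<not> a \<le> d"
  obtain q where r: "r = p * q" using assms by auto
  have "hcomp d r = 0" using \<open>\<not> a \<le> d\<close> assms by (simp add: r hcomp_mult)
  moreover have "hcomp d r = r"
    using assms(2) by (intro poly_mapping_eqI) (auto simp: lookup_hcomp when_def homogeneous_def in_keys_iff)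
  ultimately show False using assms by simp
qed

section \<open>Linear forms as prime elements\<close>

definition lform :: "nat \<Rightarrow> (nat \<Rightarrow> real) \<Rightarrow> rpoly" where
  "lform k c = (\<Sum>i<k. const (c i) * var i)"

lemma lookup_lform: "lookup (lform k c) (single j 1) = (if j < k then c j else 0)"
proof -
  have inj: "single i (1::nat) = single j 1 \<longleftrightarrow> i = j" for i
    by (metis keys_single one_neq_zero singleton_inject)
  have "const a * var i = single (single i 1) a" for a i
    by (simp add: const_def var_def mult_single)
  then have "lookup (lform k c) (single j 1) = (\<Sum>i<k. if i = j then c i else 0)"
    by (auto simp: lform_def lookup_sum lookup_single when_def inj[unfolded One_nat_def] intro!: sum.cong)
  then show ?thesis by simp
qed

lemma lform_eq_0_iff: "lform k c = 0 \<longleftrightarrow> (\<forall>i<k. c i = 0)"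
proof
  assume "lform k c = 0"
  then show "\<forall>i<k. c i = 0" using lookup_lform[of k c] by (metis lookup_zero)
qed (simp add: lform_def)

lemma homogeneous_lform: "homogeneous 1 (lform k c)"
proof -
  have "homogeneous (0 + 1) (const a * var i)" for a i
    by (rule homogeneous_mult[OF homogeneous_const]) (simp add: homogeneous_def var_def mon_deg_def)
  then show ?thesis unfolding lform_def by (intro homogeneous_sum) simp
qed

lemma in_RDelta_lform: "in_RDelta k (lform k c)"
  unfolding lform_def by (intro in_RDelta_sum in_RDelta_mult) (auto simp: in_RDelta_var)

text \<open>Solving a nonzero linear form for one of its variables gives a ring endomorphism whose
  kernel is the ideal generated by the form.\<close>

lemma lform_kernel:
  assumes "j < k" "c j \<noteq> 0"
  defines "f \<equiv> var(j := var j - const (1 / c j) * lform k c)"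
  shows "lform k c dvd p \<longleftrightarrow> psubst f p = 0"
    and "psubst f (lform k d) = lform k (\<lambda>i. d i - d j / c j * c i)"
proof -
  have lin: "psubst f (lform k d) = lform k (\<lambda>i. d i - d j / c j * c i)" for d
  proof -
    have "psubst f (lform k d) = (\<Sum>i<k. const (d i) * f i)"
      by (simp add: lform_def psubst_sum psubst_mult)
    also have "\<dots> = (\<Sum>i<k. const (d i) * var i
        - (if i = j then const (d j) * (const (1 / c j) * lform k c) else 0))"
      by (intro sum.cong) (auto simp: f_def algebra_simps)
    also have "\<dots> = lform k d - const (d j) * (const (1 / c j) * lform k c)"
      using \<open>j < k\<close> by (simp add: sum_subtractf lform_def)
    also have "const (d j) * (const (1 / c j) * lform k c) = (\<Sum>i<k. const (d j / c j * c i) * var i)"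
      by (simp add: lform_def sum_distrib_left mult.assoc const_mult[symmetric] flip: mult.assoc)
    also have "lform k d - \<dots> = lform k (\<lambda>i. d i - d j / c j * c i)"
      by (simp add: lform_def const_diff sum_subtractf left_diff_distrib)
    finally show ?thesis .
  qed
  then show "psubst f (lform k d) = lform k (\<lambda>i. d i - d j / c j * c i)" .
  have ker: "psubst f (lform k c) = 0"
    unfolding lin using assms by (simp add: lform_eq_0_iff)
  show "lform k c dvd p \<longleftrightarrow> psubst f p = 0"
  proof
    assume "lform k c dvd p"
    then show "psubst f p = 0" using ker by (auto simp: psubst_mult)
  next
    assume "psubst f p = 0"
    \<comment> \<open>\<open>f\<close> differs from \<open>var\<close> only at \<open>j\<close>, and
      there by a multiple of the form, so \<open>p\<close> is congruent to its image.\<close>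
    moreover have "lform k c dvd psubst var p - psubst f p"
      by (rule dvd_psubst_diff) (auto simp: f_def)
    ultimately show "lform k c dvd p" by (simp add: psubst_var_id)
  qed
qed

text \<open>Divisibility by the form is vanishing under a ring homomorphism into a domain, so the
  ideal it generates is prime.\<close>

lemma prime_elem_lform:
  assumes "lform k c \<noteq> 0"
  shows "prime_elem (lform k c)"
proof -
  obtain j where j: "j < k" "c j \<noteq> 0" using assms by (auto simp: lform_eq_0_iff)
  note dvd = lform_kernel(1)[where c=c, OF j]
  have "\<not> lform k c dvd 1"
    unfolding dvd using psubst_const[of _ 1] by simp
  then show ?thesis using assms by (intro prime_elemI) (auto simp: dvd psubst_mult)
qed

text \<open>Eliminating variable \<open>j\<close> sends the divisible form to 0, but also to an
  explicit linear form; comparing coefficients gives the ratio \<open>d j / c j\<close>.\<close>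

lemma lform_dvd_lform:
  assumes "lform k c \<noteq> 0" "lform k c dvd lform k d"
  obtains t where "\<And>i. i < k \<Longrightarrow> d i = t * c i"
proof -
  obtain j where j: "j < k" "c j \<noteq> 0" using assms by (auto simp: lform_eq_0_iff)
  have "lform k (\<lambda>i. d i - d j / c j * c i) = 0"
    using assms(2) lform_kernel[where c=c, OF j] by simp
  then show ?thesis using that[of "d j / c j"] by (auto simp: lform_eq_0_iff)
qed

lemma prime_elem_dvd_prodD:
  fixes f :: "'a \<Rightarrow> 'b::idom"
  assumes "prime_elem p" "p dvd (\<Prod>a\<in>A. f a)" "finite A"
  shows "\<exists>a\<in>A. p dvd f a"
  using assms(3,2)
proof (induction A rule: finite_induct)
  case empty
  then show ?case using assms(1) prime_elem_not_unit by auto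
next
  case (insert x F)
  then show ?case using assms(1) by (auto simp: prime_elem_dvd_mult_iff)
qed

text \<open>A further prime does not divide the product of the earlier ones, so it must divide the
  cofactor.\<close>

lemma prod_dvd_of_prime_elems:
  fixes f :: "'a \<Rightarrow> 'b::idom"
  assumes "finite A" "\<And>a. a \<in> A \<Longrightarrow> prime_elem (f a)" "\<And>a. a \<in> A \<Longrightarrow> f a dvd p"
    and "\<And>a b. a \<in> A \<Longrightarrow> b \<in> A \<Longrightarrow> a \<noteq> b \<Longrightarrow> \<not> f a dvd f b"
  shows "(\<Prod>a\<in>A. f a) dvd p"
  using assms
proof (induction A rule: finite_induct)
  case (insert a A)
  then obtain q where q: "p = prod f A * q" by (meson dvdE insertCI)
  have "prime_elem (f a)" "f a dvd prod f A * q" using insert.prems q by auto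
  moreover have "\<not> f a dvd prod f A"
    using insert.hyps insert.prems
    by (metis insertCI prime_elem_dvd_prodD)
  ultimately have "f a dvd q" using prime_elem_dvd_mult_iff by blast
  then show ?case using insert.hyps by (auto simp: q mult.commute intro: mult_dvd_mono)
qed simp

text \<open>Cancels the congruent factors \<open>a\<close> and \<open>b\<close> modulo a prime not
  dividing them. This carries edge congruences from numerators to quotients, both for divided
  differences and for division by \<open>- y \<gamma>\<close>.\<close>

lemma dvd_quotient_diff:
  fixes p :: "'a::idom"
  assumes "prime_elem p" "p dvd a * x - b * y" "p dvd a - b" "\<not> p dvd a"
  shows "p dvd x - y"
proof -
  have "a * (x - y) = (a * x - b * y) - (a - b) * y" by (simp add: algebra_simps)
  then have "p dvd a * (x - y)" using assms(2,3) by (metis dvd_diff dvd_mult2)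
  then show ?thesis using assms(1,4) prime_elem_dvd_mult_iff by blast
qed

lemma dvd_diff_swap: "d dvd a - b \<Longrightarrow> d dvd b - a" for d :: "'a::comm_ring_1"
  by (metis dvd_minus_iff minus_diff_eq)

section \<open>Root systems and inversions\<close>

lemma refl_involutive [simp]: "refl a (refl a x) = x"
  by (cases "a = 0") (simp_all add: refl_def inner_diff_left field_simps)

lemma refl_comp_refl [simp]: "refl a \<circ> (refl a \<circ> w) = w"
  by (simp add: fun_eq_iff)

lemma linear_refl: "linear (refl a)"
  unfolding refl_def
  by (rule linearI) (simp_all add: inner_add_left distrib_left add_divide_distrib scaleR_add_left
      scaleR_diff_right mult.left_commute)

lemma refl_self [simp]: "refl a a = - a"
  by (cases "a = 0") (simp_all add: refl_def scaleR_2)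

lemma refl_uminus [simp]: "refl (- a) = refl a"
  by (simp add: refl_def fun_eq_iff)

lemma refl_inner_refl [simp]: "refl a x \<bullet> refl a y = x \<bullet> y"
  by (cases "a = 0") (simp_all add: refl_def inner_diff_left inner_diff_right inner_commute field_simps)

lemma linear_isometry_refl:
  assumes "linear w" "\<And>x y. w x \<bullet> w y = x \<bullet> y"
  shows "w (refl a x) = refl (w a) (w x)"
  by (simp add: refl_def linear_diff[OF assms(1)] linear_scale[OF assms(1)] assms(2))

section \<open>Coordinates with respect to the base\<close>

locale root_base =
  fixes \<Phi> :: "'v::euclidean_space set" and alpha :: "nat \<Rightarrow> 'v" and k :: nat
  assumes rs: "root_system \<Phi>" and base: "is_base \<Phi> alpha k"
begin

abbreviation "Pos \<equiv> pos_roots \<Phi> alpha k"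
abbreviation "W \<equiv> weyl alpha k"
abbreviation "V \<equiv> span (alpha ` {..<k})"

text \<open>The base need not span the whole space, so a coordinate functional is chosen as some
  linear extension; only its values on \<open>V\<close> are determined.\<close>

definition dual :: "nat \<Rightarrow> 'v \<Rightarrow> real" where
  "dual i = (SOME g. linear g \<and> (\<forall>j<k. g (alpha j) = (if j = i then 1 else 0)))"

lemma dual: "linear (dual i)" "j < k \<Longrightarrow> dual i (alpha j) = (if j = i then 1 else 0)"
proof -
  have "independent (alpha ` {..<k})" and inj: "inj_on alpha {..<k}"
    using base by (auto simp: is_base_def)
  then obtain g :: "'v \<Rightarrow> real" where "linear g" and
    g: "\<forall>x\<in>alpha ` {..<k}. g x = (if the_inv_into {..<k} alpha x = i then 1 else 0)"
    using linear_independent_extend[of "alpha ` {..<k}" "\<lambda>x. if the_inv_into {..<k} alpha x = i then 1 else 0"]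
    by blast
  then have "\<exists>g. linear g \<and> (\<forall>j<k. g (alpha j) = (if j = i then 1 else 0 :: real))"
    using the_inv_into_f_f[OF inj] by (intro exI[of _ g]) auto
  from someI_ex[OF this] show "linear (dual i)" "j < k \<Longrightarrow> dual i (alpha j) = (if j = i then 1 else 0)"
    unfolding dual_def by auto
qed

lemmas dual_linear = linear_add[OF dual(1)] linear_diff[OF dual(1)] linear_scale[OF dual(1)]
  linear_neg[OF dual(1)] linear_0[OF dual(1)]

lemma dual_sum: "i < k \<Longrightarrow> dual i (\<Sum>j<k. c j *\<^sub>R alpha j) = c i"
proof -
  assume "i < k"
  have "dual i (\<Sum>j<k. c j *\<^sub>R alpha j) = (\<Sum>j<k. if j = i then c j else 0)"
    by (simp add: linear_sum[OF dual(1)] dual_linear dual(2) if_distrib[of "\<lambda>x. _ * x"] cong: if_cong)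
  then show ?thesis using \<open>i < k\<close> by simp
qed

lemma span_expand: "v \<in> V \<Longrightarrow> v = (\<Sum>i<k. dual i v *\<^sub>R alpha i)"
proof (rule linear_eq_on_span[of "\<lambda>v. v" "\<lambda>v. \<Sum>i<k. dual i v *\<^sub>R alpha i"])
  show "linear (\<lambda>v. v :: 'v)" by (rule linear_ident)
  show "linear (\<lambda>v. \<Sum>i<k. dual i v *\<^sub>R alpha i)"
    by (rule linearI) (simp_all add: dual_linear scaleR_add_left sum.distrib scaleR_sum_right)
  fix x assume "x \<in> alpha ` {..<k}"
  then obtain j where j: "j < k" "x = alpha j" by auto
  have "(\<Sum>i<k. dual i (alpha j) *\<^sub>R alpha i) = (\<Sum>i<k. if i = j then alpha i else 0)"
    using j by (intro sum.cong) (auto simp: dual(2))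
  then show "x = (\<Sum>i<k. dual i x *\<^sub>R alpha i)" using j by simp
qed

lemma alpha_V: "i < k \<Longrightarrow> alpha i \<in> V"
  by (simp add: span_base)

lemma coords_eq: "v \<in> V \<Longrightarrow> i < k \<Longrightarrow> coords alpha k v i = dual i v"
proof -
  assume "v \<in> V" "i < k"
  then have "\<exists>c. v = (\<Sum>i<k. c i *\<^sub>R alpha i)"
    by (intro exI[of _ "\<lambda>i. dual i v"] span_expand)
  then have "v = (\<Sum>i<k. coords alpha k v i *\<^sub>R alpha i)"
    unfolding coords_def by (rule someI_ex)
  then show ?thesis using dual_sum[OF \<open>i < k\<close>, of "coords alpha k v"] by simp
qed

text \<open>Agrees with \<open>lin\<close> on \<open>V\<close> but is linear everywhere, whereas
  \<open>coords\<close> is an unspecified choice off \<open>V\<close>.\<close>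

definition L :: "'v \<Rightarrow> rpoly" where "L v = lform k (\<lambda>i. dual i v)"

lemma lin_eq: "v \<in> V \<Longrightarrow> lin alpha k v = L v"
  unfolding lin_def L_def lform_def by (intro sum.cong) (auto simp: coords_eq)

lemma L_diff: "L (v - w) = L v - L w"
  by (simp add: L_def lform_def dual_linear const_diff left_diff_distrib sum_subtractf)

lemma L_scaleR: "L (c *\<^sub>R v) = const c * L v"
  by (simp add: L_def lform_def dual_linear const_mult sum_distrib_left mult.assoc)

lemma L_uminus: "L (- v) = - L v"
  using L_diff[of 0 v] L_diff[of 0 0] by simp

lemma L_eq_0_iff: "v \<in> V \<Longrightarrow> L v = 0 \<longleftrightarrow> v = 0"
proof
  assume "v \<in> V" "L v = 0"
  then show "v = 0" using span_expand[of v] by (simp add: L_def lform_eq_0_iff)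
qed (simp add: L_def lform_eq_0_iff dual_linear)

lemma prime_elem_L: "v \<in> V \<Longrightarrow> v \<noteq> 0 \<Longrightarrow> prime_elem (L v)"
  using L_eq_0_iff prime_elem_lform unfolding L_def by blast

lemma L_dvd_L:
  assumes "v \<in> V" "w \<in> V" "v \<noteq> 0" "L v dvd L w"
  shows "\<exists>t. w = t *\<^sub>R v"
proof -
  have "lform k (\<lambda>i. dual i v) \<noteq> 0" using assms(1,3) L_eq_0_iff by (simp add: L_def)
  then obtain t where t: "\<And>i. i < k \<Longrightarrow> dual i w = t * dual i v"
    using lform_dvd_lform assms(4) unfolding L_def by blast
  have "w = (\<Sum>i<k. dual i w *\<^sub>R alpha i)" by (rule span_expand[OF assms(2)])
  also have "\<dots> = t *\<^sub>R (\<Sum>i<k. dual i v *\<^sub>R alpha i)"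
    by (simp add: t scaleR_sum_right)
  also have "(\<Sum>i<k. dual i v *\<^sub>R alpha i) = v" by (rule span_expand[OF assms(1), symmetric])
  finally show ?thesis ..
qed

lemma homogeneous_L: "homogeneous 1 (L v)" and in_RDelta_L: "in_RDelta k (L v)"
  by (simp_all only: L_def homogeneous_lform in_RDelta_lform)

section \<open>Heights and positive roots\<close>

definition ht :: "'v \<Rightarrow> real" where "ht v = (\<Sum>i<k. dual i v)"

lemma ht_linear: "ht (v + w) = ht v + ht w" "ht (v - w) = ht v - ht w"
  "ht (c *\<^sub>R v) = c * ht v" "ht (- v) = - ht v" "ht 0 = 0"
  by (simp_all add: ht_def dual_linear sum.distrib sum_subtractf sum_distrib_left sum_negf)

lemma ht_sum: "ht (\<Sum>x\<in>A. f x) = (\<Sum>x\<in>A. ht (f x))"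
  by (induction A rule: infinite_finite_induct) (auto simp: ht_linear)

lemma ht_alpha: "i < k \<Longrightarrow> ht (alpha i) = 1"
  by (simp add: ht_def dual(2) sum.delta)

lemma root_nz: "\<beta> \<in> \<Phi> \<Longrightarrow> \<beta> \<noteq> 0" using rs by (auto simp: root_system_def)

lemma finite_Phi: "finite \<Phi>" using rs by (auto simp: root_system_def)

lemma refl_root: "\<alpha> \<in> \<Phi> \<Longrightarrow> \<beta> \<in> \<Phi> \<Longrightarrow> refl \<alpha> \<beta> \<in> \<Phi>"
  using rs unfolding root_system_def by blast

lemma uminus_root: "\<beta> \<in> \<Phi> \<Longrightarrow> - \<beta> \<in> \<Phi>"
  using refl_root[of \<beta> \<beta>] by simp

lemma cartan_int: "\<alpha> \<in> \<Phi> \<Longrightarrow> \<beta> \<in> \<Phi> \<Longrightarrow> (2 * (\<beta> \<bullet> \<alpha>)) / (\<alpha> \<bullet> \<alpha>) \<in> \<int>"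
  using rs unfolding root_system_def by blast

lemma root_multiple: "\<alpha> \<in> \<Phi> \<Longrightarrow> c *\<^sub>R \<alpha> \<in> \<Phi> \<Longrightarrow> c *\<^sub>R \<alpha> = \<alpha> \<or> c *\<^sub>R \<alpha> = - \<alpha>"
  using rs unfolding root_system_def by fastforce

lemma alpha_root: "i < k \<Longrightarrow> alpha i \<in> \<Phi>"
  using base by (auto simp: is_base_def)

lemma root_expand:
  assumes "\<beta> \<in> \<Phi>"
  obtains c :: "nat \<Rightarrow> int" where "\<beta> = (\<Sum>i<k. of_int (c i) *\<^sub>R alpha i)"
    "\<And>i. i < k \<Longrightarrow> dual i \<beta> = of_int (c i)" "(\<forall>i<k. c i \<ge> 0) \<or> (\<forall>i<k. c i \<le> 0)"
proof -
  obtain c :: "nat \<Rightarrow> int" where c: "\<beta> = (\<Sum>i<k. of_int (c i) *\<^sub>R alpha i)"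
    "(\<forall>i<k. c i \<ge> 0) \<or> (\<forall>i<k. c i \<le> 0)"
    using assms base unfolding is_base_def by blast
  show ?thesis by (rule that[OF c(1) _ c(2)]) (simp add: c(1) dual_sum)
qed

lemma root_V: "\<beta> \<in> \<Phi> \<Longrightarrow> \<beta> \<in> V"
  by (erule root_expand) (auto intro!: span_sum span_scale alpha_V)

text \<open>The coefficients of a root share one sign, so their sum vanishes only if all do. The
  sign of the single number \<open>ht \<beta>\<close> can therefore replace membership in
  \<open>Pos\<close>.\<close>

lemma ht_root:
  assumes "\<beta> \<in> \<Phi>"
  shows "ht \<beta> \<noteq> 0" "i < k \<Longrightarrow> ht \<beta> > 0 \<Longrightarrow> dual i \<beta> \<ge> 0"
    "ht \<beta> > 0 \<Longrightarrow> \<beta> \<in> Pos" "\<beta> \<in> Pos \<Longrightarrow> ht \<beta> > 0"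
proof -
  obtain c where c: "\<beta> = (\<Sum>i<k. of_int (c i) *\<^sub>R alpha i)"
    "\<And>i. i < k \<Longrightarrow> dual i \<beta> = of_int (c i)" "(\<forall>i<k. c i \<ge> 0) \<or> (\<forall>i<k. c i \<le> 0)"
    using root_expand[OF assms] by blast
  have ht: "ht \<beta> = of_int (\<Sum>i<k. c i)" using c(2) by (simp add: ht_def)
  show nz: "ht \<beta> \<noteq> 0"
  proof
    assume "ht \<beta> = 0"
    then have "(\<Sum>i<k. c i) = 0" by (simp add: ht flip: of_int_sum)
    then have "\<forall>i<k. c i = 0"
      using c(3) sum_nonneg_eq_0_iff[of "{..<k}" c] sum_nonneg_eq_0_iff[of "{..<k}" "\<lambda>i. - c i"]
      unfolding sum_negf by fastforce
    then show False using c(1) root_nz[OF assms] by simp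
  qed
  have cn: "\<forall>i<k. c i \<ge> 0" if "ht \<beta> > 0"
  proof (rule ccontr)
    assume "\<not> ?thesis"
    then have "(\<Sum>i<k. c i) \<le> 0" using c(3) by (intro sum_nonpos) auto
    then show False using that by (simp add: ht flip: of_int_sum)
  qed
  then show "i < k \<Longrightarrow> ht \<beta> > 0 \<Longrightarrow> dual i \<beta> \<ge> 0" by (simp add: c(2))
  show "\<beta> \<in> Pos" if "ht \<beta> > 0"
  proof -
    have "\<beta> = (\<Sum>i<k. real (nat (c i)) *\<^sub>R alpha i)"
      using cn[OF that] by (subst c(1)) (auto intro!: sum.cong)
    then show ?thesis using assms unfolding pos_roots_def by (auto intro!: exI[of _ "\<lambda>i. nat (c i)"])
  qed
  show "ht \<beta> > 0" if "\<beta> \<in> Pos"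
  proof -
    obtain d :: "nat \<Rightarrow> nat" where "\<beta> = (\<Sum>i<k. real (d i) *\<^sub>R alpha i)"
      using \<open>\<beta> \<in> Pos\<close> unfolding pos_roots_def by blast
    then have "ht \<beta> \<ge> 0"
      using dual_sum[of _ "\<lambda>i. real (d i)"] by (auto simp: ht_def intro!: sum_nonneg)
    then show ?thesis using nz by simp
  qed
qed

lemma Pos_iff: "\<beta> \<in> Pos \<longleftrightarrow> \<beta> \<in> \<Phi> \<and> ht \<beta> > 0"
  using ht_root(3,4) by (auto simp: pos_roots_def)

lemma finite_Pos: "finite Pos"
  using finite_Phi by (simp add: pos_roots_def)

lemma uminus_Pos_iff: "\<beta> \<in> uminus ` (Pos - {g}) \<longleftrightarrow> \<beta> \<in> \<Phi> \<and> ht \<beta> < 0 \<and> \<beta> \<noteq> - g"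
proof
  assume "\<beta> \<in> \<Phi> \<and> ht \<beta> < 0 \<and> \<beta> \<noteq> - g"
  then have "- \<beta> \<in> Pos - {g}" using uminus_root by (auto simp: Pos_iff ht_linear)
  then show "\<beta> \<in> uminus ` (Pos - {g})" by (metis image_eqI minus_minus)
qed (auto simp: Pos_iff ht_linear uminus_root)

lemma Pos_multiple:
  assumes "\<alpha> \<in> Pos" "c *\<^sub>R \<alpha> \<in> Pos"
  shows "c *\<^sub>R \<alpha> = \<alpha>"
proof -
  have *: "\<alpha> \<in> \<Phi>" "c *\<^sub>R \<alpha> \<in> \<Phi>" "ht \<alpha> > 0" "ht (c *\<^sub>R \<alpha>) > 0"
    using assms unfolding Pos_iff by blast+
  then have "ht (- \<alpha>) < 0" unfolding ht_linear(4) by simp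
  then have "c *\<^sub>R \<alpha> \<noteq> - \<alpha>" using *(4) by (metis less_asym)
  then show ?thesis using root_multiple[OF *(1,2)] by blast
qed

text \<open>Some coordinate \<open>j \<noteq> i\<close> of \<open>\<beta>\<close> is positive, since
  otherwise \<open>\<beta>\<close> would be a multiple of \<open>alpha i\<close>. The reflection
  changes only coordinate \<open>i\<close>, and one positive coordinate makes a root
  positive.\<close>

lemma simple_refl_Pos:
  assumes "\<beta> \<in> Pos" "i < k" "\<beta> \<noteq> alpha i"
  shows "refl (alpha i) \<beta> \<in> Pos"
proof -
  have \<beta>: "\<beta> \<in> \<Phi>" "ht \<beta> > 0" using assms(1) by (auto simp: Pos_iff)
  have "\<exists>j<k. j \<noteq> i \<and> dual j \<beta> > 0"
  proof (rule ccontr)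
    assume "\<not> ?thesis"
    then have "dual j \<beta> = 0" if "j < k" "j \<noteq> i" for j
      using ht_root(2)[OF \<beta>(1) that(1) \<beta>(2)] that by fastforce
    then have "(\<Sum>j<k. dual j \<beta> *\<^sub>R alpha j) = (\<Sum>j<k. if j = i then dual i \<beta> *\<^sub>R alpha i else 0)"
      by (intro sum.cong) auto
    then have "\<beta> = dual i \<beta> *\<^sub>R alpha i"
      using span_expand[OF root_V[OF \<beta>(1)]] \<open>i < k\<close> by simp
    moreover have "alpha i \<in> Pos" using \<open>i < k\<close> alpha_root ht_alpha by (simp add: Pos_iff)
    ultimately show False using Pos_multiple assms(1,3) by metis
  qed
  then obtain j where j: "j < k" "j \<noteq> i" "dual j \<beta> > 0" by blast
  have r: "refl (alpha i) \<beta> \<in> \<Phi>" using \<beta> \<open>i < k\<close> alpha_root refl_root by blast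
  have "dual j (refl (alpha i) \<beta>) > 0"
    using j \<open>i < k\<close> by (simp add: refl_def dual_linear dual(2))
  then have "\<not> ht (- refl (alpha i) \<beta>) > 0"
    using ht_root(2)[OF uminus_root[OF r] j(1)] by (auto simp: dual_linear)
  then show ?thesis using r ht_root(1)[OF r] by (simp add: Pos_iff ht_linear)
qed

lemma alpha_Pos: "i < k \<Longrightarrow> alpha i \<in> Pos"
  by (simp add: Pos_iff alpha_root ht_alpha)

text \<open>Only \<open>alpha i\<close> and its negative change sign; a negative root is treated by
  applying \<open>simple_refl_Pos\<close> to its negative.\<close>

lemma ht_simple_refl_neg_iff:
  assumes "\<beta> \<in> \<Phi>" "i < k"
  shows "ht (refl (alpha i) \<beta>) < 0 \<longleftrightarrow> \<beta> = alpha i \<or> (ht \<beta> < 0 \<and> \<beta> \<noteq> - alpha i)"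
proof (cases "ht \<beta> > 0")
  case True
  have "ht (refl (alpha i) \<beta>) > 0" if "\<beta> \<noteq> alpha i"
    using simple_refl_Pos[of \<beta> i] assms True that by (simp add: Pos_iff)
  moreover have "ht (refl (alpha i) (alpha i)) < 0" using assms by (simp add: ht_linear(4) ht_alpha)
  ultimately show ?thesis using True by (metis less_asym)
next
  case False
  then have lt: "ht \<beta> < 0" using ht_root(1)[OF assms(1)] by simp
  have *: "refl (alpha i) (- \<beta>) = - refl (alpha i) \<beta>" by (rule linear_neg[OF linear_refl])
  have "- \<beta> \<noteq> alpha i \<Longrightarrow> ht (refl (alpha i) (- \<beta>)) > 0"
    using simple_refl_Pos[of "- \<beta>" i] assms lt uminus_root by (auto simp: Pos_iff ht_linear)
  moreover have "\<beta> = - alpha i \<Longrightarrow> ht (refl (alpha i) \<beta>) > 0"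
    using * assms by (simp add: ht_alpha linear_neg[OF linear_refl])
  moreover have "\<beta> \<noteq> alpha i" using lt assms ht_alpha[of i] by auto
  moreover have "- \<beta> \<noteq> alpha i" if "\<beta> \<noteq> - alpha i" using that by (metis minus_minus)
  moreover have "ht (refl (alpha i) (- \<beta>)) = - ht (refl (alpha i) \<beta>)" unfolding * by (rule ht_linear(4))
  ultimately show ?thesis using lt by (metis less_asym neg_0_less_iff_less)
qed

section \<open>The Weyl group and its reflections\<close>

lemma weyl_induct [consumes 1, case_names id step]:
  assumes "w \<in> W" and "P id"
    and "\<And>w i. w \<in> W \<Longrightarrow> P w \<Longrightarrow> i < k \<Longrightarrow> P (refl (alpha i) \<circ> w)"
  shows "P w"
  using weyl.induct[of w alpha k P] assms by (simp add: id_def o_def)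

lemma weyl_props:
  assumes "w \<in> W"
  shows "linear w" "w x \<bullet> w y = x \<bullet> y" "bij w" "\<beta> \<in> \<Phi> \<Longrightarrow> w \<beta> \<in> \<Phi>"
proof -
  have "linear w \<and> (\<forall>x y. w x \<bullet> w y = x \<bullet> y) \<and> bij w \<and> (\<forall>\<beta>\<in>\<Phi>. w \<beta> \<in> \<Phi>)"
    using assms
  proof (induction rule: weyl_induct)
    case id
    show ?case using linear_ident bij_id[unfolded id_def] by (auto simp: id_def)
  next
    case (step w i)
    have "bij (refl (alpha i))" by (rule o_bij[of "refl (alpha i)"]) (auto simp: fun_eq_iff)
    moreover have "linear (refl (alpha i) \<circ> w)" "bij w"
      using step linear_compose[OF _ linear_refl] by auto
    ultimately show ?case using step bij_comp[of w "refl (alpha i)"] unfolding o_def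
      by (auto intro: refl_root alpha_root)
  qed
  then show "linear w" "w x \<bullet> w y = x \<bullet> y" "bij w" "\<beta> \<in> \<Phi> \<Longrightarrow> w \<beta> \<in> \<Phi>"
    by auto
qed

lemma weyl_comp: "u \<in> W \<Longrightarrow> w \<in> W \<Longrightarrow> u \<circ> w \<in> W"
proof (induction rule: weyl_induct)
  case (step u i)
  then show ?case using weyl.weyl_step[of "u \<circ> w" alpha k i] by (simp only: comp_assoc)
qed simp

lemma weyl_simple: "i < k \<Longrightarrow> refl (alpha i) \<in> W"
  using weyl.weyl_step[OF weyl.weyl_id, of i k alpha] by simp

lemma weyl_inv: "w \<in> W \<Longrightarrow> inv w \<in> W"
proof (induction rule: weyl_induct)
  case id
  show ?case using weyl.weyl_id[of alpha k] inv_id by (simp add: id_def)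
next
  case (step w i)
  have s: "bij (refl (alpha i))" "inv (refl (alpha i)) = refl (alpha i)"
    using weyl_props(3)[OF weyl_simple] step by (auto intro!: inv_unique_comp)
  show ?case
    using o_inv_distrib[OF s(1) weyl_props(3)[OF step(1)]] weyl_comp[OF step(3) weyl_simple[OF step(2)]]
    by (simp add: s(2) o_def)
qed

lemma weyl_refl: "w \<in> W \<Longrightarrow> w (refl a x) = refl (w a) (w x)"
  by (rule linear_isometry_refl) (auto simp: weyl_props)

lemma inv_weyl [simp]: "w \<in> W \<Longrightarrow> inv w (w x) = x" "w \<in> W \<Longrightarrow> w (inv w x) = x"
  using weyl_props(3) by (auto simp: bij_is_inj bij_is_surj surj_f_inv_f)

lemma weyl_uminus: "w \<in> W \<Longrightarrow> w (- x) = - w x"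
  by (rule linear_neg) (rule weyl_props(1))

lemma weyl_inv_root: "w \<in> W \<Longrightarrow> \<beta> \<in> \<Phi> \<Longrightarrow> inv w \<beta> \<in> \<Phi>"
  using weyl_props(4)[OF weyl_inv] .

lemma weyl_inv_uminus: "w \<in> W \<Longrightarrow> inv w (- x) = - inv w x"
  using weyl_uminus[OF weyl_inv] .

text \<open>Induction on height. Since \<open>\<beta> \<bullet> \<beta> > 0\<close>, some simple
  root has positive inner product with \<open>\<beta>\<close>. Reflecting in it lowers the height by
  a positive integer, and conjugating the reflection of the lower root gives back
  \<open>refl \<beta>\<close>.\<close>

lemma refl_Pos_weyl: "\<beta> \<in> Pos \<Longrightarrow> ht \<beta> \<le> real n \<Longrightarrow> refl \<beta> \<in> W"
proof (induction n arbitrary: \<beta>)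
  case 0
  then show ?case by (simp add: Pos_iff)
next
  case (Suc n)
  have \<beta>: "\<beta> \<in> \<Phi>" "ht \<beta> > 0" using Suc by (auto simp: Pos_iff)
  have "\<beta> \<bullet> \<beta> = (\<Sum>i<k. dual i \<beta> * (alpha i \<bullet> \<beta>))"
    using arg_cong[OF span_expand[OF root_V[OF \<beta>(1)]], of "\<lambda>x. x \<bullet> \<beta>"] by (simp add: inner_sum_left)
  moreover have "\<beta> \<bullet> \<beta> > 0" using root_nz[OF \<beta>(1)] by simp
  ultimately obtain i where i: "i < k" "dual i \<beta> * (alpha i \<bullet> \<beta>) > 0"
    by (metis (no_types, lifting) lessThan_iff not_less sum_nonpos)
  then have pos: "\<beta> \<bullet> alpha i > 0"
    using ht_root(2)[OF \<beta>(1) i(1) \<beta>(2)] by (simp add: zero_less_mult_iff inner_commute)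
  show ?case
  proof (cases "\<beta> = alpha i")
    case True
    then show ?thesis using weyl_simple i by simp
  next
    case False
    let ?c = "2 * (\<beta> \<bullet> alpha i) / (alpha i \<bullet> alpha i)"
    have "?c > 0" using pos root_nz[OF alpha_root[OF i(1)]] by simp
    moreover have "?c \<in> \<int>" using cartan_int[OF alpha_root[OF i(1)] \<beta>(1)] by simp
    ultimately have "?c \<ge> 1" by (auto elim!: Ints_cases)
    then have "ht (refl (alpha i) \<beta>) \<le> real n"
      using Suc.prems(2) i by (simp add: refl_def ht_linear ht_alpha)
    then have "refl (refl (alpha i) \<beta>) \<in> W"
      using Suc.IH simple_refl_Pos Suc.prems(1) i(1) False by blast
    then have "refl (alpha i) \<circ> (refl (refl (alpha i) \<beta>) \<circ> refl (alpha i)) \<in> W"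
      using weyl_comp weyl_simple i(1) by blast
    moreover have "refl (alpha i) \<circ> (refl (refl (alpha i) \<beta>) \<circ> refl (alpha i)) = refl \<beta>"
      using weyl_refl[OF weyl_simple[OF i(1)]] by (simp add: fun_eq_iff)
    ultimately show ?thesis by simp
  qed
qed

lemma refl_weyl: "\<beta> \<in> \<Phi> \<Longrightarrow> refl \<beta> \<in> W"
proof -
  assume \<beta>: "\<beta> \<in> \<Phi>"
  have *: "refl \<beta> \<in> W" if "\<beta> \<in> Pos" for \<beta>
    using refl_Pos_weyl[OF that] real_arch_simple by blast
  show ?thesis
  proof (cases "ht \<beta> > 0")
    case True
    then show ?thesis using * \<beta> by (simp add: Pos_iff)
  next
    case False
    then have "- \<beta> \<in> Pos" using \<beta> ht_root(1)[OF \<beta>] uminus_root by (simp add: Pos_iff ht_linear)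
    then show ?thesis using *[of "- \<beta>"] by simp
  qed
qed

text \<open>An element is determined by its restriction to the finite set \<open>\<Phi>\<close>: it
  is linear on \<open>V\<close>, and it fixes the orthogonal complement of \<open>V\<close> because
  every simple reflection does.\<close>

lemma finite_weyl: "finite W"
proof (rule inj_on_finite)
  show "inj_on (\<lambda>w. restrict w \<Phi>) W"
  proof (rule inj_onI)
    fix u w assume u: "u \<in> W" and w: "w \<in> W" and eq: "restrict u \<Phi> = restrict w \<Phi>"
    have eqV: "u x = w x" if "x \<in> V" for x
    proof (rule linear_eq_on_span[OF weyl_props(1)[OF u] weyl_props(1)[OF w] _ that])
      fix x assume "x \<in> alpha ` {..<k}"
      then have "x \<in> \<Phi>" using alpha_root by auto
      then show "u x = w x" using eq by (metis restrict_apply')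
    qed
    have fix_perp: "v z = z" if "v \<in> W" "\<And>y. y \<in> V \<Longrightarrow> orthogonal z y" for v z
      using that(1)
    proof (induction rule: weyl_induct)
      case (step v i)
      then show ?case using that(2)[OF alpha_V[of i]] by (simp add: refl_def orthogonal_def)
    qed simp
    show "u = w"
    proof
      fix x
      obtain y z where "y \<in> V" "\<And>v. v \<in> V \<Longrightarrow> orthogonal z v" "x = y + z"
        using orthogonal_subspace_decomp_exists[of "alpha ` {..<k}" x] by blast
      moreover from this have "u z = z" "w z = z" using fix_perp u w by blast+
      ultimately show "u x = w x"
        using eqV[of y] u w by (simp add: linear_add[OF weyl_props(1)])
    qed
  qed
  show "(\<lambda>w. restrict w \<Phi>) ` W \<subseteq> \<Phi> \<rightarrow>\<^sub>E \<Phi>"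
    using weyl_props(4) by auto
  show "finite (\<Phi> \<rightarrow>\<^sub>E \<Phi>)" using finite_Phi by (intro finite_PiE) auto
qed

text \<open>Labels of the edges that end at \<open>w\<close> in the graph obtained by excluding the root \<open>g\<close>; since
  \<open>0\<close> is not a root, \<open>g = 0\<close> gives the full Bruhat graph.\<close>

definition in_labels :: "'v \<Rightarrow> ('v \<Rightarrow> 'v) \<Rightarrow> 'v set" where
  "in_labels g w = {\<alpha> \<in> Pos. ht (inv w \<alpha>) < 0 \<and> inv w \<alpha> \<noteq> - g}"

lemma finite_in_labels: "finite (in_labels g w)"
  using finite_Pos by (simp add: in_labels_def)

section \<open>Edges and inversion counts\<close>

lemma hedge_iff: "hedge \<Phi> alpha k g u w \<alpha> \<longleftrightarrow> w \<in> W \<and> \<alpha> \<in> in_labels g w \<and> u = refl \<alpha> \<circ> w"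
proof
  assume h: "hedge \<Phi> alpha k g u w \<alpha>"
  then have "refl \<alpha> \<in> W" "u \<in> W" "w = refl \<alpha> \<circ> u" using refl_weyl by (auto simp: hedge_def Pos_iff)
  moreover from this have "w \<in> W" using weyl_comp by blast
  ultimately show "w \<in> W \<and> \<alpha> \<in> in_labels g w \<and> u = refl \<alpha> \<circ> w"
    using h uminus_Pos_iff by (auto simp: hedge_def in_labels_def)
next
  assume h: "w \<in> W \<and> \<alpha> \<in> in_labels g w \<and> u = refl \<alpha> \<circ> w"
  then have "\<alpha> \<in> Pos" "\<alpha> \<in> \<Phi>" by (auto simp: in_labels_def Pos_iff)
  then have "u \<in> W" "inv w \<alpha> \<in> \<Phi>" using h refl_weyl weyl_comp weyl_inv_root by blast+
  then show "hedge \<Phi> alpha k g u w \<alpha>"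
    using h \<open>\<alpha> \<in> Pos\<close> uminus_Pos_iff by (auto simp: hedge_def in_labels_def)
qed

lemma hedge_weyl:
  assumes "hedge \<Phi> alpha k g u w \<alpha>"
  shows "u \<in> W" "w \<in> W" "\<alpha> \<in> Pos" "\<alpha> \<in> \<Phi>" "w = refl \<alpha> \<circ> u"
  using assms hedge_iff[of g u w \<alpha>] by (auto simp: hedge_def Pos_iff)

text \<open>A reflection negates only multiples of its root, and proportional positive roots
  coincide. Hence incoming edges can be counted by their labels.\<close>

lemma refl_inj_Pos:
  assumes "\<alpha> \<in> Pos" "\<beta> \<in> Pos" "refl \<alpha> = refl \<beta>"
  shows "\<alpha> = \<beta>"
proof -
  let ?c = "(2 * (\<alpha> \<bullet> \<beta>)) / (\<beta> \<bullet> \<beta>)"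
  have "refl \<beta> \<alpha> = - \<alpha>" using assms(3)[symmetric] by simp
  then have "\<alpha> - ?c *\<^sub>R \<beta> = - \<alpha>" unfolding refl_def .
  then have "2 *\<^sub>R \<alpha> = ?c *\<^sub>R \<beta>" unfolding scaleR_2 by (metis add_diff_cancel diff_minus_eq_add minus_diff_eq)
  then have "(1/2) *\<^sub>R (2 *\<^sub>R \<alpha>) = (1/2) *\<^sub>R (?c *\<^sub>R \<beta>)" by (rule arg_cong)
  then have "\<alpha> = (1/2 * ?c) *\<^sub>R \<beta>" unfolding scaleR_scaleR by simp
  then show ?thesis using Pos_multiple[OF assms(2), of "1/2 * ?c"] assms(1) by simp
qed

lemma hlen_eq: "w \<in> W \<Longrightarrow> hlen \<Phi> alpha k g w = card (in_labels g w)"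
proof -
  assume w: "w \<in> W"
  have "{u. \<exists>\<alpha>. hedge \<Phi> alpha k g u w \<alpha>} = (\<lambda>\<alpha>. refl \<alpha> \<circ> w) ` in_labels g w"
    using w by (auto simp: hedge_iff)
  moreover have "inj_on (\<lambda>\<alpha>. refl \<alpha> \<circ> w) (in_labels g w)"
  proof (rule inj_onI)
    fix a b assume *: "a \<in> in_labels g w" "b \<in> in_labels g w" "refl a \<circ> w = refl b \<circ> w"
    then have "refl a x = refl b x" for x using w by (metis comp_apply inv_weyl(2))
    then have "refl a = refl b" by blast
    then show "a = b" using * refl_inj_Pos by (simp add: in_labels_def)
  qed
  ultimately show ?thesis by (simp add: hlen_def card_image)
qed

lemma in_labels_eq: "w \<in> W \<Longrightarrow> {\<alpha>. hedge \<Phi> alpha k g (refl \<alpha> \<circ> w) w \<alpha>} = in_labels g w"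
  by (auto simp: hedge_iff)

text \<open>The number of inversions of \<open>inv w\<close>, that is, the Coxeter length of
  \<open>w\<close>. It measures length for every \<open>g\<close>, also when edges are
  excluded.\<close>

definition N :: "('v \<Rightarrow> 'v) \<Rightarrow> nat" where "N w = card (in_labels 0 w)"

lemma in_labels_0: "w \<in> W \<Longrightarrow> in_labels 0 w = {\<alpha> \<in> Pos. ht (inv w \<alpha>) < 0}"
  by (auto simp: in_labels_def Pos_iff ht_linear)

lemma inv_comp_refl: "w \<in> W \<Longrightarrow> a \<in> \<Phi> \<Longrightarrow> inv (refl a \<circ> w) x = inv w (refl a x)"
proof -
  assume w: "w \<in> W" and a: "a \<in> \<Phi>"
  have "(refl a \<circ> w) (inv w (refl a x)) = x" using w by simp
  then show ?thesis using weyl_comp[OF refl_weyl[OF a] w] by (metis inv_weyl(1))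
qed

lemma inv_comp_refl_right: "w \<in> W \<Longrightarrow> a \<in> \<Phi> \<Longrightarrow> inv (w \<circ> refl a) x = refl a (inv w x)"
proof -
  assume w: "w \<in> W" and a: "a \<in> \<Phi>"
  have "(w \<circ> refl a) (refl a (inv w x)) = x" using w by simp
  then show ?thesis using weyl_comp[OF w refl_weyl[OF a]] by (metis inv_weyl(1))
qed

text \<open>The simple reflection permutes the positive roots other than \<open>alpha i\<close>, so
  it carries the old inversions to new ones, and \<open>alpha i\<close> itself is added.\<close>

lemma N_simple_left:
  assumes w: "w \<in> W" and i: "i < k" and pos: "ht (inv w (alpha i)) > 0"
  shows "N (refl (alpha i) \<circ> w) = Suc (N w)"
proof -
  let ?s = "refl (alpha i)"
  have nin: "alpha i \<notin> in_labels 0 w" using pos by (simp add: in_labels_def)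
  have eq: "in_labels 0 (?s \<circ> w) = insert (alpha i) (?s ` in_labels 0 w)" (is "?L = ?R")
  proof
    show "?L \<subseteq> ?R"
    proof
      fix \<beta> assume \<beta>: "\<beta> \<in> ?L"
      then have b: "\<beta> \<in> Pos" "ht (inv w (?s \<beta>)) < 0"
        using w i alpha_root by (auto simp: in_labels_def inv_comp_refl)
      show "\<beta> \<in> ?R"
      proof (cases "\<beta> = alpha i")
        case False
        then have "?s \<beta> \<in> in_labels 0 w" using simple_refl_Pos b i w by (simp add: in_labels_0)
        then show ?thesis by (metis image_eqI insertI2 refl_involutive)
      qed simp
    qed
    show "?R \<subseteq> ?L"
    proof (rule insert_subsetI)
      have "?s \<circ> w \<in> W" using w i weyl_comp weyl_simple by blast
      then show "alpha i \<in> ?L" using pos w i alpha_root alpha_Pos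
        by (simp add: in_labels_0 inv_comp_refl weyl_inv_uminus ht_linear)
      show "?s ` in_labels 0 w \<subseteq> ?L"
      proof (rule image_subsetI)
        fix \<beta> assume b: "\<beta> \<in> in_labels 0 w"
        then have "\<beta> \<noteq> alpha i" using nin by auto
        then have "?s \<beta> \<in> Pos" using b i simple_refl_Pos by (auto simp: in_labels_def)
        then show "?s \<beta> \<in> ?L"
          using b \<open>?s \<circ> w \<in> W\<close> w i alpha_root by (simp add: in_labels_0 inv_comp_refl)
      qed
    qed
  qed
  have "alpha i \<notin> ?s ` in_labels 0 w"
  proof
    assume "alpha i \<in> ?s ` in_labels 0 w"
    then obtain b where "b \<in> in_labels 0 w" "alpha i = ?s b" by auto
    then have "b = - alpha i" using refl_involutive[of "alpha i" b] by simp
    then show False using \<open>b \<in> in_labels 0 w\<close> i by (simp add: in_labels_def Pos_iff ht_linear ht_alpha)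
  qed
  moreover have "inj_on ?s (in_labels 0 w)" by (metis inj_onI refl_involutive)
  ultimately show ?thesis unfolding N_def eq using finite_in_labels by (simp add: card_image)
qed

lemma N_simple_left':
  assumes w: "w \<in> W" and i: "i < k" and neg: "ht (inv w (alpha i)) < 0"
  shows "N w = Suc (N (refl (alpha i) \<circ> w))"
proof -
  have "refl (alpha i) \<circ> w \<in> W" using w i weyl_comp weyl_simple by blast
  moreover have "ht (inv (refl (alpha i) \<circ> w) (alpha i)) > 0"
    using neg w i alpha_root by (simp add: inv_comp_refl weyl_inv_uminus ht_linear)
  ultimately show ?thesis using N_simple_left[of "refl (alpha i) \<circ> w" i] i by simp
qed

text \<open>Since only \<open>alpha i\<close> and its negative change sign, the label set itself
  grows by one root. This gives the leading term of a right divided difference.\<close>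

lemma in_labels_simple_right:
  assumes w: "w \<in> W" and i: "i < k" and pos: "ht (w (alpha i)) > 0"
  shows "in_labels 0 (w \<circ> refl (alpha i)) = insert (w (alpha i)) (in_labels 0 w)" "w (alpha i) \<notin> in_labels 0 w"
proof -
  have ws: "w \<circ> refl (alpha i) \<in> W" using w i weyl_comp weyl_simple by blast
  have wp: "w (alpha i) \<in> Pos" using pos w i weyl_props(4) alpha_root by (simp add: Pos_iff)
  show "w (alpha i) \<notin> in_labels 0 w" using w i by (simp add: in_labels_0 ht_alpha)
  have "ht (refl (alpha i) (inv w \<beta>)) < 0 \<longleftrightarrow> \<beta> = w (alpha i) \<or> ht (inv w \<beta>) < 0" if "\<beta> \<in> Pos" for \<beta>
  proof -
    have \<beta>: "\<beta> \<in> \<Phi>" "ht \<beta> > 0" using that by (auto simp: Pos_iff)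
    have "inv w \<beta> \<noteq> - alpha i"
    proof
      assume "inv w \<beta> = - alpha i"
      then have "\<beta> = - w (alpha i)" using w by (metis inv_weyl(2) weyl_uminus)
      then show False using \<beta> pos by (simp add: ht_linear)
    qed
    moreover have "inv w \<beta> = alpha i \<longleftrightarrow> \<beta> = w (alpha i)" using w by (metis inv_weyl)
    ultimately show ?thesis
      using ht_simple_refl_neg_iff[OF weyl_inv_root[OF w \<beta>(1)] i] by blast
  qed
  then show "in_labels 0 (w \<circ> refl (alpha i)) = insert (w (alpha i)) (in_labels 0 w)"
    using w ws wp i alpha_root by (auto simp: in_labels_0 inv_comp_refl_right)
qed

lemma N_simple_right:
  "w \<in> W \<Longrightarrow> i < k \<Longrightarrow> ht (w (alpha i)) > 0 \<Longrightarrow> N (w \<circ> refl (alpha i)) = Suc (N w)"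
  using in_labels_simple_right finite_in_labels by (simp add: N_def)

text \<open>The map \<open>f\<close> injects the labels at \<open>u\<close> into those at
  \<open>w\<close> other than \<open>\<alpha>\<close>: it reflects a root in \<open>\<alpha>\<close>
  when the result is positive and leaves it in place otherwise.\<close>

lemma hedge_N_less:
  assumes "hedge \<Phi> alpha k g u w \<alpha>"
  shows "N u < N w"
proof -
  note h = hedge_weyl[OF assms]
  have neg: "ht (inv w \<alpha>) < 0" using assms by (simp add: hedge_iff in_labels_def)
  have inv_u: "inv u x = inv w (refl \<alpha> x)" for x
    using h assms inv_comp_refl[of w \<alpha> x] by (simp add: hedge_iff)
  have pos: "ht (inv u \<alpha>) > 0"
    using neg h by (simp add: inv_u weyl_inv_uminus ht_linear)
  have inv_w: "inv w x = inv u (refl \<alpha> x)" for x by (simp add: inv_u)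
  define f where "f \<beta> = (if ht (refl \<alpha> \<beta>) > 0 then refl \<alpha> \<beta> else \<beta>)" for \<beta>
  have f_in: "f \<beta> \<in> in_labels 0 w - {\<alpha>}" if "\<beta> \<in> in_labels 0 u" for \<beta>
  proof -
    have \<beta>: "\<beta> \<in> \<Phi>" "ht \<beta> > 0" "ht (inv u \<beta>) < 0" using that by (auto simp: in_labels_def Pos_iff)
    have r: "refl \<alpha> \<beta> \<in> \<Phi>" using h \<beta> refl_root by blast
    show ?thesis
    proof (cases "ht (refl \<alpha> \<beta>) > 0")
      case True
      have "refl \<alpha> \<beta> \<noteq> \<alpha>"
      proof
        assume "refl \<alpha> \<beta> = \<alpha>"
        then have "\<beta> = - \<alpha>" by (metis refl_involutive refl_self)
        then show False using \<beta> h(3) by (simp add: ht_linear Pos_iff)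
      qed
      then show ?thesis using True r \<beta> by (simp add: f_def in_labels_0[OF h(2)] Pos_iff inv_w)
    next
      case False
      \<comment> \<open>A reflection that is not positive forces a positive coefficient here, so
        \<open>inv w \<beta>\<close> is the negative root \<open>inv u \<beta>\<close> minus a
        positive multiple of the positive root \<open>inv u \<alpha>\<close>.\<close>
      let ?c = "(2 * (\<beta> \<bullet> \<alpha>)) / (\<alpha> \<bullet> \<alpha>)"
      have "ht \<beta> - ?c * ht \<alpha> \<le> 0" using False by (simp add: refl_def ht_linear)
      then have "?c * ht \<alpha> > 0" using \<beta> by simp
      moreover have "ht \<alpha> > 0" using h(3) by (simp add: Pos_iff)
      ultimately have "?c > 0" by (rule zero_less_mult_pos2)
      then have "?c * ht (inv u \<alpha>) > 0" using pos by (rule mult_pos_pos)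
      moreover have "inv w \<beta> = inv u \<beta> - ?c *\<^sub>R inv u \<alpha>"
        using weyl_props(1)[OF weyl_inv[OF h(1)]] by (simp add: inv_w refl_def linear_diff linear_scale)
      ultimately have "ht (inv w \<beta>) < 0" using \<beta> by (simp add: ht_linear)
      moreover have "\<beta> \<noteq> \<alpha>" using \<beta> pos by auto
      ultimately show ?thesis using False \<beta> by (simp add: f_def in_labels_0[OF h(2)] Pos_iff)
    qed
  qed
  \<comment> \<open>In the mixed case \<open>refl \<alpha> x = y\<close>, the reflection of
    \<open>y\<close> is the positive root \<open>x\<close>, so \<open>y\<close> would have been
    reflected too.\<close>
  have "inj_on f (in_labels 0 u)"
  proof (rule inj_onI)
    fix x y assume "x \<in> in_labels 0 u" "y \<in> in_labels 0 u" "f x = f y"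
    moreover from this have "ht x > 0" "ht y > 0" by (auto simp: in_labels_def Pos_iff)
    ultimately show "x = y"
      unfolding f_def by (metis refl_involutive)
  qed
  then have "N u \<le> card (in_labels 0 w - {\<alpha>})"
    unfolding N_def using f_in finite_in_labels by (intro card_inj_on_le) auto
  also have "\<alpha> \<in> in_labels 0 w" using neg h(3) by (simp add: in_labels_0[OF h(2)])
  then have "card (in_labels 0 w - {\<alpha>}) < N w"
    unfolding N_def using finite_in_labels by (intro card_Diff1_less)
  finally show ?thesis .
qed

lemma hless_N_less: "hless \<Phi> alpha k g u w \<Longrightarrow> N u < N w"
  unfolding hless_def by (induction rule: tranclp_induct) (auto dest: hedge_N_less less_trans)

lemma hedge_hless: "hedge \<Phi> alpha k g u w \<alpha> \<Longrightarrow> hless \<Phi> alpha k g u w"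
  unfolding hless_def by blast

lemma hless_hedge: "hless \<Phi> alpha k g x u \<Longrightarrow> hedge \<Phi> alpha k g u w \<alpha> \<Longrightarrow> hless \<Phi> alpha k g x w"
  unfolding hless_def by (rule tranclp.trancl_into_trancl) blast+

lemma bruhat_less_eq: "bruhat_less \<Phi> alpha k = hless \<Phi> alpha k 0"
proof -
  have "0 \<notin> Pos" using root_nz by (auto simp: Pos_iff)
  then have "bruhat_step \<Phi> alpha k = (\<lambda>u w. \<exists>\<alpha>. hedge \<Phi> alpha k 0 u w \<alpha>)"
    by (auto simp: fun_eq_iff bruhat_step_def hedge_def)
  then show ?thesis by (simp add: bruhat_less_def hless_def)
qed

section \<open>GKM classes and Schubert classes\<close>

abbreviation "GK \<equiv> GKM \<Phi> alpha k"
abbreviation "hl \<equiv> hless \<Phi> alpha k"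

lemma Pos_V: "\<alpha> \<in> Pos \<Longrightarrow> \<alpha> \<in> V" using root_V by (simp add: Pos_iff)

lemma prime_elem_L_root: "\<alpha> \<in> \<Phi> \<Longrightarrow> prime_elem (L \<alpha>)"
  using prime_elem_L root_V root_nz by blast

lemma L_root_nz: "\<alpha> \<in> \<Phi> \<Longrightarrow> L \<alpha> \<noteq> 0"
  using L_eq_0_iff root_V root_nz by blast

lemma L_dvd_L_root:
  assumes "\<alpha> \<in> \<Phi>" "\<beta> \<in> \<Phi>" "L \<alpha> dvd L \<beta>"
  shows "\<beta> = \<alpha> \<or> \<beta> = - \<alpha>"
  using L_dvd_L[OF root_V root_V root_nz] assms root_multiple by blast

text \<open>By cancellation the cofactor lies in the subring automatically, so an edge condition is
  plain divisibility, indexed by the upper endpoint and its labels.\<close>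

lemma GKM_iff:
  "P \<in> GK g \<longleftrightarrow> (\<forall>w. w \<notin> W \<longrightarrow> P w = 0) \<and> (\<forall>w\<in>W. in_RDelta k (P w))
     \<and> (\<forall>w\<in>W. \<forall>\<alpha>\<in>in_labels g w. L \<alpha> dvd P (refl \<alpha> \<circ> w) - P w)"
proof -
  have "(\<exists>q. in_RDelta k q \<and> P u - P w = lin alpha k \<alpha> * q) \<longleftrightarrow> L \<alpha> dvd P u - P w"
    if "\<forall>w\<in>W. in_RDelta k (P w)" "hedge \<Phi> alpha k g u w \<alpha>" for u w \<alpha>
  proof -
    have h: "u \<in> W" "w \<in> W" "\<alpha> \<in> \<Phi>" using hedge_weyl[OF that(2)] by auto
    then have "in_RDelta k (P u - P w)" using that(1) in_RDelta_diff by blast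
    then show ?thesis
      unfolding dvd_def lin_eq[OF root_V[OF h(3)]]
      using in_RDelta_cancel[OF in_RDelta_L L_root_nz[OF h(3)]] by metis
  qed
  then have *: "(\<forall>w\<in>W. in_RDelta k (P w)) \<Longrightarrow>
    (\<forall>u w \<alpha>. hedge \<Phi> alpha k g u w \<alpha> \<longrightarrow> (\<exists>q. in_RDelta k q \<and> P u - P w = lin alpha k \<alpha> * q))
    \<longleftrightarrow> (\<forall>u w \<alpha>. hedge \<Phi> alpha k g u w \<alpha> \<longrightarrow> L \<alpha> dvd P u - P w)"
    by meson
  show ?thesis unfolding GKM_def mem_Collect_eq using * unfolding hedge_iff by blast
qed

lemma GKM_in_RDelta: "P \<in> GK g \<Longrightarrow> in_RDelta k (P w)"
  by (cases "w \<in> W") (auto simp: GKM_iff)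

lemma GKM_zero: "(\<lambda>_. 0) \<in> GK g"
  by (simp add: GKM_iff)

lemma GKM_add: "P \<in> GK g \<Longrightarrow> Q \<in> GK g \<Longrightarrow> (\<lambda>w. P w + Q w) \<in> GK g"
  unfolding GKM_iff by (auto simp: in_RDelta_add add_diff_add)

lemma GKM_smult: "P \<in> GK g \<Longrightarrow> in_RDelta k f \<Longrightarrow> (\<lambda>w. f * P w) \<in> GK g"
  unfolding GKM_iff by (auto simp: in_RDelta_mult simp flip: right_diff_distrib)

lemma GKM_diff: "P \<in> GK g \<Longrightarrow> Q \<in> GK g \<Longrightarrow> (\<lambda>w. P w - Q w) \<in> GK g"
  using GKM_add[of P g "\<lambda>w. const (- 1) * Q w"] GKM_smult[of Q g "const (- 1)"]
    in_RDelta_const[of k "- 1"]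
  by (simp add: const_def single_uminus)

lemma GKM_sum: "(\<And>i. i \<in> A \<Longrightarrow> P i \<in> GK g) \<Longrightarrow> (\<lambda>w. \<Sum>i\<in>A. P i w) \<in> GK g"
  by (induction A rule: infinite_finite_induct) (auto intro: GKM_zero GKM_add)

text \<open>Frees the edge condition from the direction of the edge and the sign of the root: one of
  the two endpoints is the upper one. For \<open>g = 0\<close> both exclusions hold for every
  root.\<close>

lemma GKM_refl_dvd:
  assumes P: "P \<in> GK g" and y: "y \<in> W" and \<beta>: "\<beta> \<in> \<Phi>" "inv y \<beta> \<noteq> g" "inv y \<beta> \<noteq> - g"
  shows "L \<beta> dvd P (refl \<beta> \<circ> y) - P y"
proof -
  have pos: "L \<beta> dvd P (refl \<beta> \<circ> y) - P y"
    if b: "\<beta> \<in> Pos" "inv y \<beta> \<noteq> g" "inv y \<beta> \<noteq> - g" for \<beta>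
  proof (cases "ht (inv y \<beta>) < 0")
    case True
    then have "\<beta> \<in> in_labels g y" using b by (simp add: in_labels_def)
    then show ?thesis using P y by (auto simp: GKM_iff)
  next
    case False
    have \<beta>: "\<beta> \<in> \<Phi>" using b by (simp add: Pos_iff)
    let ?u = "refl \<beta> \<circ> y"
    have u: "?u \<in> W" using weyl_comp refl_weyl \<beta> y by blast
    have "ht (inv y \<beta>) > 0" using False ht_root(1)[OF weyl_inv_root[OF y \<beta>]] by simp
    moreover have "inv ?u \<beta> = - inv y \<beta>"
      using inv_comp_refl[OF y \<beta>] y by (simp add: weyl_inv_uminus)
    ultimately have "\<beta> \<in> in_labels g ?u" using b by (simp add: in_labels_def ht_linear)
    then have "L \<beta> dvd P (refl \<beta> \<circ> ?u) - P ?u" using P u unfolding GKM_iff by blast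
    then have "L \<beta> dvd P y - P ?u" by simp
    then show ?thesis by (rule dvd_diff_swap)
  qed
  show ?thesis
  proof (cases "\<beta> \<in> Pos")
    case False
    then have "- \<beta> \<in> Pos" using \<beta>(1) ht_root(1)[OF \<beta>(1)] uminus_root by (simp add: Pos_iff ht_linear)
    moreover have "inv y (- \<beta>) \<noteq> g" "inv y (- \<beta>) \<noteq> - g"
      using \<beta> y by (auto simp: weyl_inv_uminus)
    ultimately show ?thesis using pos[of "- \<beta>"] by (simp add: L_uminus)
  qed (use pos \<beta> in blast)
qed

text \<open>Each incoming label divides \<open>P x\<close> because the class vanishes at the lower
  endpoint, and distinct positive roots give primes that do not divide each other.\<close>

lemma prod_in_labels_dvd:
  assumes P: "P \<in> GK g" and x: "x \<in> W" and 0: "\<And>\<alpha>. \<alpha> \<in> in_labels g x \<Longrightarrow> P (refl \<alpha> \<circ> x) = 0"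
  shows "(\<Prod>\<alpha>\<in>in_labels g x. L \<alpha>) dvd P x"
proof (rule prod_dvd_of_prime_elems[OF finite_in_labels])
  fix a assume a: "a \<in> in_labels g x"
  then show "prime_elem (L a)" by (auto simp: in_labels_def Pos_iff intro: prime_elem_L_root)
  have "L a dvd P (refl a \<circ> x) - P x" using P x a by (auto simp: GKM_iff)
  then show "L a dvd P x" using 0[OF a] by simp
  fix b assume b: "b \<in> in_labels g x" "a \<noteq> b"
  have ab: "a \<in> \<Phi>" "b \<in> \<Phi>" "ht a > 0" "ht b > 0" using a b by (auto simp: in_labels_def Pos_iff)
  then have "b \<noteq> - a" using ht_linear(4)[of a] by (metis less_asym neg_less_0_iff_less)
  then show "\<not> L a dvd L b" using L_dvd_L_root[OF ab(1,2)] b(2) by blast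
qed

lemma prod_in_labels: "homogeneous (card (in_labels g x)) (\<Prod>\<alpha>\<in>in_labels g x. L \<alpha>)"
  "in_RDelta k (\<Prod>\<alpha>\<in>in_labels g x. L \<alpha>)" "(\<Prod>\<alpha>\<in>in_labels g x. L \<alpha>) \<noteq> 0"
proof -
  show "homogeneous (card (in_labels g x)) (\<Prod>\<alpha>\<in>in_labels g x. L \<alpha>)"
    by (rule homogeneous_prod[OF finite_in_labels homogeneous_L])
  show "in_RDelta k (\<Prod>\<alpha>\<in>in_labels g x. L \<alpha>)" by (rule in_RDelta_prod[OF in_RDelta_L])
  show "(\<Prod>\<alpha>\<in>in_labels g x. L \<alpha>) \<noteq> 0"
    using finite_in_labels[of g x] by (auto simp: in_labels_def Pos_iff L_root_nz)
qed

text \<open>Only points with at most \<open>d\<close> incoming edges need checking. At any other bad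
  point of least \<open>N\<close> the class vanishes at all lower neighbours, so its value would be
  divisible by a form of too large a degree.\<close>

lemma support_hless:
  assumes P: "P \<in> GK g" and hom: "\<And>w. w \<in> W \<Longrightarrow> homogeneous d (P w)"
    and low: "\<And>y. y \<in> W \<Longrightarrow> P y \<noteq> 0 \<Longrightarrow> card (in_labels g y) \<le> d \<Longrightarrow> y = x \<or> hl g x y"
  shows "y \<in> W \<Longrightarrow> P y \<noteq> 0 \<Longrightarrow> y = x \<or> hl g x y"
proof (induction "N y" arbitrary: y rule: less_induct)
  case less
  show ?case
  proof (rule ccontr)
    assume n: "\<not> ?thesis"
    have "P (refl \<alpha> \<circ> y) = 0" if "\<alpha> \<in> in_labels g y" for \<alpha>
    proof (rule ccontr)
      assume nz: "P (refl \<alpha> \<circ> y) \<noteq> 0"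
      have e: "hedge \<Phi> alpha k g (refl \<alpha> \<circ> y) y \<alpha>" using that less.prems by (simp add: hedge_iff)
      then have "refl \<alpha> \<circ> y = x \<or> hl g x (refl \<alpha> \<circ> y)"
        using less.hyps[OF hedge_N_less[OF e] hedge_weyl(1)[OF e] nz] by blast
      then show False using n e hedge_hless hless_hedge by metis
    qed
    then have "(\<Prod>\<alpha>\<in>in_labels g y. L \<alpha>) dvd P y" using prod_in_labels_dvd P less.prems by blast
    then have "card (in_labels g y) \<le> d"
      using homogeneous_dvd_le[OF prod_in_labels(1) hom] less.prems by blast
    then show False using low less.prems n by blast
  qed
qed

lemma flow_up_iff:
  assumes x: "x \<in> W"
  shows "flow_up \<Phi> alpha k g x P \<longleftrightarrow> P \<in> GK g \<and> (\<forall>w\<in>W. homogeneous (card (in_labels g x)) (P w))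
    \<and> P x = (\<Prod>\<alpha>\<in>in_labels g x. L \<alpha>) \<and> (\<forall>y\<in>W. P y \<noteq> 0 \<longrightarrow> y = x \<or> hl g x y)"
proof -
  have "(\<Prod>\<alpha>\<in>in_labels g x. lin alpha k \<alpha>) = (\<Prod>\<alpha>\<in>in_labels g x. L \<alpha>)"
    by (intro prod.cong refl lin_eq Pos_V) (auto simp: in_labels_def)
  then show ?thesis
    unfolding flow_up_def GKM_deg_def hlen_eq[OF x] in_labels_eq[OF x] by auto
qed

text \<open>Paths strictly raise \<open>N\<close>, so flow-up classes are triangular with respect to
  \<open>N\<close> for every \<open>g\<close>.\<close>

lemma flow_up_low:
  assumes "x \<in> W" "flow_up \<Phi> alpha k g x P" "y \<in> W" "P y \<noteq> 0" "N y \<le> N x"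
  shows "y = x"
  using assms hless_N_less[of g x y] by (auto simp: flow_up_iff)

section \<open>Schubert classes on the full Bruhat graph\<close>

lemma in_labels_top:
  assumes w: "w \<in> W" and top: "\<And>i. i < k \<Longrightarrow> ht (w (alpha i)) < 0"
  shows "in_labels 0 w = Pos"
proof -
  have neg: "ht (w \<delta>) < 0" if "\<delta> \<in> Pos" for \<delta>
  proof -
    have d: "\<delta> \<in> \<Phi>" "ht \<delta> > 0" using that by (auto simp: Pos_iff)
    have "w \<delta> = (\<Sum>i<k. dual i \<delta> *\<^sub>R w (alpha i))"
      using arg_cong[OF span_expand[OF root_V[OF d(1)]], of w] weyl_props(1)[OF w]
      by (simp add: linear_sum linear_scale)
    then have "ht (w \<delta>) = (\<Sum>i<k. dual i \<delta> * ht (w (alpha i)))" by (simp add: ht_sum ht_linear)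
    also have "\<dots> \<le> 0"
      using ht_root(2)[OF d(1) _ d(2)] less_imp_le[OF top]
      by (intro sum_nonpos mult_nonneg_nonpos) auto
    finally show ?thesis using ht_root(1)[OF weyl_props(4)[OF w d(1)]] by simp
  qed
  have "ht (inv w \<beta>) < 0" if "\<beta> \<in> Pos" for \<beta>
  proof (rule ccontr)
    assume "\<not> ?thesis"
    then have "inv w \<beta> \<in> Pos"
      using that w weyl_inv_root ht_root(1)[OF weyl_inv_root[OF w]] by (force simp: Pos_iff)
    then have "ht \<beta> < 0" using neg[of "inv w \<beta>"] w by simp
    then show False using that by (simp add: Pos_iff)
  qed
  then show ?thesis using w by (auto simp: in_labels_0)
qed

text \<open>The class at \<open>w\<close> is the right divided difference of the class at \<open>w s\<^sub>i\<close>.\<close>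

lemma schubert_class_step:
  assumes w: "w \<in> W" and i: "i < k" and asc: "ht (w (alpha i)) > 0"
    and Q: "flow_up \<Phi> alpha k 0 (w \<circ> refl (alpha i)) Q"
  shows "\<exists>P. flow_up \<Phi> alpha k 0 w P"
proof -
  let ?s = "refl (alpha i)"
  have ai: "alpha i \<in> \<Phi>" using i alpha_root by blast
  have ws: "y \<circ> ?s \<in> W" if "y \<in> W" for y using that i weyl_comp weyl_simple by blast
  have ya: "y (alpha i) \<in> \<Phi>" if "y \<in> W" for y using that ai weyl_props(4) by blast
  have ss: "y \<circ> ?s \<circ> ?s = y" for y :: "'v \<Rightarrow> 'v" by (simp add: fun_eq_iff)
  \<comment> \<open>Right multiplication by the simple reflection moves along a reflection edge
    labelled up to sign by \<open>y (alpha i)\<close>, so the difference of \<open>Q\<close> is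
    divisible by that root.\<close>
  have right: "y \<circ> ?s = refl (y (alpha i)) \<circ> y" if "y \<in> W" for y
    using weyl_refl[OF that] by (simp add: fun_eq_iff)
  note Q' = Q[unfolded flow_up_iff[OF ws[OF w]]]
  have QG: "Q \<in> GK 0" using Q' by blast
  have Qdvd: "L \<beta> dvd Q (refl \<beta> \<circ> y) - Q y" if "y \<in> W" "\<beta> \<in> \<Phi>" for y \<beta>
    using GKM_refl_dvd[OF QG that] root_nz[OF weyl_inv_root[OF that]] by simp
  define P where "P y = (if y \<in> W then SOME q. Q (y \<circ> ?s) - Q y = L (y (alpha i)) * q else 0)" for y
  have P: "L (y (alpha i)) * P y = Q (y \<circ> ?s) - Q y" if "y \<in> W" for y
  proof -
    have "\<exists>q. Q (y \<circ> ?s) - Q y = L (y (alpha i)) * q"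
      using Qdvd[OF that ya[OF that]] unfolding right[OF that] dvd_def .
    from someI_ex[OF this] show ?thesis using that by (simp add: P_def)
  qed
  have Nw: "N (w \<circ> ?s) = Suc (N w)" using N_simple_right w i asc by blast
  have cw: "card (in_labels 0 (w \<circ> ?s)) = 1 + card (in_labels 0 w)" using Nw by (simp add: N_def)
  have Qhom: "homogeneous (1 + card (in_labels 0 w)) (Q y)" if "y \<in> W" for y
    using Q' that unfolding cw by blast
  have Qlow: "y = w \<circ> ?s" if "y \<in> W" "Q y \<noteq> 0" "N y \<le> Suc (N w)" for y
    using flow_up_low[OF ws[OF w] Q that(1,2)] that(3) Nw by simp
  have PG: "P \<in> GK 0"
    unfolding GKM_iff
  proof (intro conjI ballI allI impI)
    fix y show "y \<notin> W \<Longrightarrow> P y = 0" by (simp add: P_def)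
  next
    fix y assume y: "y \<in> W"
    have "in_RDelta k (L (y (alpha i)) * P y)"
      unfolding P[OF y] by (intro in_RDelta_diff GKM_in_RDelta[OF QG])
    then show "in_RDelta k (P y)"
      by (rule in_RDelta_cancel[OF in_RDelta_L L_root_nz[OF ya[OF y]]])
  next
    fix y \<alpha> assume y: "y \<in> W" and "\<alpha> \<in> in_labels 0 y"
    then have \<alpha>: "\<alpha> \<in> \<Phi>" by (simp add: in_labels_def Pos_iff)
    let ?u = "refl \<alpha> \<circ> y"
    have u: "?u \<in> W" using weyl_comp refl_weyl \<alpha> y by blast
    show "L \<alpha> dvd P ?u - P y"
    proof (cases "y (alpha i) = \<alpha> \<or> y (alpha i) = - \<alpha>")
      \<comment> \<open>The edge joins \<open>y\<close> to \<open>y \<circ> ?s\<close>; numerator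
        and denominator both change sign, so the quotient does not change.\<close>
      case True
      then have us: "?u = y \<circ> ?s" unfolding right[OF y] by auto
      have "?u (alpha i) = - y (alpha i)" unfolding us using y by (simp add: weyl_uminus)
      then have "- (L (y (alpha i)) * P ?u) = Q (?u \<circ> ?s) - Q ?u"
        using P[OF u] by (simp add: L_uminus)
      also have "?u \<circ> ?s = y" unfolding us by (rule ss)
      also have "Q y - Q ?u = - (L (y (alpha i)) * P y)" using P[OF y] unfolding us by simp
      finally have "P ?u = P y"
        using L_root_nz[OF ya[OF y]] unfolding neg_equal_iff_equal by (metis mult_left_cancel)
      then show ?thesis by simp
    next
      case False
      \<comment> \<open>Away from that edge the denominators are congruent modulo
        \<open>L \<alpha>\<close>, as are the numerators by the edge conditions at \<open>y\<close>
        and at \<open>y \<circ> ?s\<close>, and \<open>L \<alpha>\<close> can be cancelled against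
        neither denominator.\<close>
      have dab: "L \<alpha> dvd L (?u (alpha i)) - L (y (alpha i))"
        by (simp add: refl_def L_diff L_scaleR)
      have "L \<alpha> dvd (Q (refl \<alpha> \<circ> (y \<circ> ?s)) - Q (y \<circ> ?s)) - (Q ?u - Q y)"
        using Qdvd[OF ws[OF y] \<alpha>] Qdvd[OF y \<alpha>] by (rule dvd_diff)
      also have "\<dots> = L (?u (alpha i)) * P ?u - L (y (alpha i)) * P y"
        unfolding P[OF y] P[OF u] by (simp add: comp_assoc)
      finally have d: "L \<alpha> dvd L (?u (alpha i)) * P ?u - L (y (alpha i)) * P y" .
      have "\<not> L \<alpha> dvd L (y (alpha i))" using L_dvd_L_root[OF \<alpha> ya[OF y]] False by blast
      then have "\<not> L \<alpha> dvd L (?u (alpha i))" using dab by (metis dvd_add_right_iff diff_add_cancel dvd_diff_swap)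
      then show ?thesis using dvd_quotient_diff[OF prime_elem_L_root[OF \<alpha>] d dab] by blast
    qed
  qed
  have hom: "homogeneous (card (in_labels 0 w)) (P y)" if y: "y \<in> W" for y
  proof -
    have "homogeneous (1 + card (in_labels 0 w)) (L (y (alpha i)) * P y)"
      unfolding P[OF y] by (intro homogeneous_diff Qhom y ws)
    then show ?thesis by (rule homogeneous_cancel[OF homogeneous_L L_root_nz[OF ya[OF y]]])
  qed
  have Qw: "Q w = 0"
  proof (rule ccontr)
    assume "Q w \<noteq> 0"
    then have "w = w \<circ> ?s" using Qlow w by simp
    then show False using Nw by simp
  qed
  have "L (w (alpha i)) * P w = (\<Prod>\<alpha>\<in>in_labels 0 (w \<circ> ?s). L \<alpha>)"
    using P[OF w] Q' Qw by simp
  also have "\<dots> = L (w (alpha i)) * (\<Prod>\<alpha>\<in>in_labels 0 w. L \<alpha>)"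
    using in_labels_simple_right[OF w i asc] finite_in_labels by simp
  finally have Pw: "P w = (\<Prod>\<alpha>\<in>in_labels 0 w. L \<alpha>)" using L_root_nz[OF ya[OF w]] by simp
  \<comment> \<open>At such a \<open>y\<close> the class \<open>Q\<close> vanishes, so the value
    comes from \<open>y \<circ> ?s\<close>, whose \<open>N\<close> exceeds that of \<open>y\<close>
    by at most one; there triangularity of \<open>Q\<close> applies.\<close>
  have low: "y = w" if y: "y \<in> W" and nz: "P y \<noteq> 0" and le: "N y \<le> N w" for y
  proof -
    have "Q y = 0" using Qlow[OF y] le Nw by (metis le_SucI Suc_n_not_le_n)
    then have "Q (y \<circ> ?s) \<noteq> 0" using P[OF y] nz L_root_nz[OF ya[OF y]] by auto
    moreover have "N (y \<circ> ?s) \<le> Suc (N y)"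
    proof (cases "ht (y (alpha i)) > 0")
      case False
      then have "ht ((y \<circ> ?s) (alpha i)) > 0"
        using y ht_root(1)[OF ya[OF y]] by (simp add: weyl_uminus ht_linear)
      then show ?thesis using N_simple_right[OF ws[OF y] i] unfolding ss by simp
    qed (use N_simple_right y i in simp)
    ultimately have "y \<circ> ?s = w \<circ> ?s" using Qlow[OF ws[OF y]] le by simp
    then show ?thesis using ss by metis
  qed
  have "y = w \<or> hl 0 w y" if "y \<in> W" "P y \<noteq> 0" for y
    using support_hless[OF PG hom _ that] low by (metis N_def)
  then have "flow_up \<Phi> alpha k 0 w P"
    unfolding flow_up_iff[OF w] using PG hom Pw by blast
  then show ?thesis by (rule exI[of _ P])
qed

text \<open>Descending induction on \<open>N\<close>, which is bounded by \<open>card Pos\<close>: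
  each step passes to a longer element by an ascent on the right.\<close>

lemma schubert_class_exists: "w \<in> W \<Longrightarrow> \<exists>P. flow_up \<Phi> alpha k 0 w P"
proof (induction "card Pos - N w" arbitrary: w rule: less_induct)
  case less
  show ?case
  proof (cases "\<forall>i<k. ht (w (alpha i)) < 0")
    case True
    \<comment> \<open>With no ascent left every positive root is an incoming label, so a class
      supported at \<open>w\<close> alone meets every edge condition.\<close>
    define P where "P y = (if y = w then (\<Prod>\<alpha>\<in>in_labels 0 w. L \<alpha>) else 0)" for y
    have "L \<alpha> dvd P y" if "\<alpha> \<in> Pos" for \<alpha> y
      using that in_labels_top[OF less.prems] True finite_in_labels[of 0 w] by (auto simp: P_def intro: dvd_prodI)
    moreover have "in_RDelta k (P y)" for y using prod_in_labels(2) by (simp add: P_def)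
    moreover have "P y = 0" if "y \<notin> W" for y using that less.prems by (auto simp: P_def)
    ultimately have "P \<in> GK 0"
      unfolding GKM_iff by (auto simp: in_labels_def intro: dvd_diff)
    then have "flow_up \<Phi> alpha k 0 w P"
      unfolding flow_up_iff[OF less.prems] by (auto simp: P_def prod_in_labels)
    then show ?thesis by (rule exI[of _ P])
  next
    case False
    then obtain i where i: "i < k" "\<not> ht (w (alpha i)) < 0" by blast
    then have asc: "ht (w (alpha i)) > 0"
      using ht_root(1)[OF weyl_props(4)[OF less.prems alpha_root]] by (simp add: less_le not_less)
    let ?w = "w \<circ> refl (alpha i)"
    have ws: "?w \<in> W" using less.prems i weyl_comp weyl_simple by blast
    have "N ?w = Suc (N w)" using N_simple_right less.prems i(1) asc by blast
    moreover have "N ?w \<le> card Pos" unfolding N_def by (rule card_mono) (auto simp: finite_Pos in_labels_def)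
    ultimately have "card Pos - N ?w < card Pos - N w" by simp
    then show ?thesis using less.hyps ws schubert_class_step less.prems i(1) asc by blast
  qed
qed

end

section \<open>Flow-up classes for the highest root\<close>

locale highest_root = root_base \<Phi> alpha k
    for \<Phi> :: "'v::euclidean_space set" and alpha :: "nat \<Rightarrow> 'v" and k :: nat +
  fixes \<gamma> :: 'v
  assumes gamma_Pos: "\<gamma> \<in> Pos" and highest: "\<And>\<alpha>. \<alpha> \<in> \<Phi> \<Longrightarrow> prec_eq \<Phi> alpha k \<alpha> \<gamma>"
begin

section \<open>Dominance of the highest root along Bruhat paths\<close>

lemma gamma_root: "\<gamma> \<in> \<Phi>" "ht \<gamma> > 0"
  using gamma_Pos by (auto simp: Pos_iff)

text \<open>A negative inner product would make \<open>refl (alpha i) \<gamma>\<close> a root of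
  larger height than \<open>\<gamma>\<close>.\<close>

lemma gamma_simple: "i < k \<Longrightarrow> \<gamma> \<bullet> alpha i \<ge> 0"
proof (rule ccontr)
  assume i: "i < k" and "\<not> \<gamma> \<bullet> alpha i \<ge> 0"
  then have c: "(2 * (\<gamma> \<bullet> alpha i)) / (alpha i \<bullet> alpha i) < 0" (is "?c < 0")
    using root_nz[OF alpha_root[OF i]] by (simp add: divide_neg_pos)
  obtain f :: "'v \<Rightarrow> nat" where f: "\<gamma> - refl (alpha i) \<gamma> = (\<Sum>x\<in>Pos. real (f x) *\<^sub>R x)"
    using highest[OF refl_root[OF alpha_root[OF i] gamma_root(1)]] unfolding prec_eq_def by blast
  have "ht (\<gamma> - refl (alpha i) \<gamma>) \<ge> 0"
    unfolding f ht_sum ht_linear by (intro sum_nonneg) (auto simp: Pos_iff)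
  moreover have "\<gamma> - refl (alpha i) \<gamma> = ?c *\<^sub>R alpha i" by (simp add: refl_def)
  ultimately show False using c ht_alpha[OF i] by (simp add: ht_linear)
qed

lemma gamma_dominant:
  assumes "\<beta> \<in> Pos"
  shows "\<gamma> \<bullet> \<beta> \<ge> 0"
proof -
  have b: "\<beta> \<in> \<Phi>" "ht \<beta> > 0" using assms by (auto simp: Pos_iff)
  have "\<gamma> \<bullet> \<beta> = (\<Sum>i<k. dual i \<beta> * (\<gamma> \<bullet> alpha i))"
    using arg_cong[OF span_expand[OF root_V[OF b(1)]], of "\<lambda>x. \<gamma> \<bullet> x"] by (simp add: inner_sum_right)
  then show ?thesis using ht_root(2)[OF b(1) _ b(2)] gamma_simple by (auto intro!: sum_nonneg mult_nonneg_nonneg)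
qed

text \<open>By isometry \<open>u \<gamma> \<bullet> \<alpha>\<close> equals the pairing of
  \<open>\<gamma>\<close> with the positive root \<open>inv u \<alpha>\<close>, so reflecting
  \<open>u \<gamma>\<close> subtracts a nonnegative multiple of \<open>\<alpha>\<close>.\<close>

lemma ht_gamma_antimono:
  assumes "hedge \<Phi> alpha k 0 u y \<alpha>"
  shows "ht (y \<gamma>) \<le> ht (u \<gamma>)"
proof -
  note h = hedge_weyl[OF assms]
  have u: "u = refl \<alpha> \<circ> y" "ht (inv y \<alpha>) < 0" using assms by (auto simp: hedge_iff in_labels_def)
  have "inv u \<alpha> = - inv y \<alpha>" unfolding u(1) using h by (simp add: inv_comp_refl weyl_inv_uminus)
  then have "inv u \<alpha> \<in> Pos" using u(2) weyl_inv_root[OF h(1,4)] by (simp add: Pos_iff ht_linear)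
  then have "\<gamma> \<bullet> inv u \<alpha> \<ge> 0" by (rule gamma_dominant)
  then have "u \<gamma> \<bullet> \<alpha> \<ge> 0" using weyl_props(2)[OF h(1), of \<gamma> "inv u \<alpha>"] h(1) by simp
  then have "(2 * (u \<gamma> \<bullet> \<alpha>)) / (\<alpha> \<bullet> \<alpha>) * ht \<alpha> \<ge> 0" using h(3) by (simp add: Pos_iff)
  moreover have "y \<gamma> = u \<gamma> - ((2 * (u \<gamma> \<bullet> \<alpha>)) / (\<alpha> \<bullet> \<alpha>)) *\<^sub>R \<alpha>"
    by (subst h(5)) (simp only: comp_apply refl_def)
  ultimately show ?thesis by (simp only: ht_linear)
qed

text \<open>A removed edge starts at some \<open>u\<close> with \<open>u \<gamma> = \<alpha>\<close>
  positive. Negativity of \<open>w \<gamma>\<close> persists along Bruhat paths, so such a path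
  never uses a removed edge.\<close>

lemma hless_neg:
  assumes "hl 0 w y" "ht (w \<gamma>) < 0"
  shows "hl \<gamma> w y" "ht (y \<gamma>) < 0"
proof -
  have edge: "hedge \<Phi> alpha k \<gamma> u y \<alpha> \<and> ht (y \<gamma>) < 0" if e: "hedge \<Phi> alpha k 0 u y \<alpha>" "ht (u \<gamma>) < 0" for u y \<alpha>
  proof -
    note h = hedge_weyl[OF e(1)]
    have u: "u = refl \<alpha> \<circ> y" using e by (simp add: hedge_iff)
    have "inv y \<alpha> \<noteq> - \<gamma>"
    proof
      assume "inv y \<alpha> = - \<gamma>"
      then have "\<alpha> = - y \<gamma>" using h(2) by (metis inv_weyl(2) weyl_uminus)
      then have "u \<gamma> = \<alpha>" unfolding u by (metis comp_apply minus_minus refl_self refl_uminus)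
      then show False using e(2) h(3) by (simp add: Pos_iff)
    qed
    then have "hedge \<Phi> alpha k \<gamma> u y \<alpha>" using e(1) by (simp add: hedge_iff in_labels_def)
    then show ?thesis using ht_gamma_antimono[OF e(1)] e(2) by simp
  qed
  have "hl \<gamma> w y \<and> ht (y \<gamma>) < 0"
    using assms(1) unfolding hless_def[of _ _ _ 0]
  proof (induction rule: tranclp_induct)
    case (base y)
    then show ?case using edge assms(2) hedge_hless by blast
  next
    case (step y z)
    then show ?case using edge hless_hedge by blast
  qed
  then show "hl \<gamma> w y" "ht (y \<gamma>) < 0" by auto
qed

lemma hedge_full: "hedge \<Phi> alpha k g u w \<alpha> \<Longrightarrow> hedge \<Phi> alpha k 0 u w \<alpha>"
  by (auto simp: hedge_iff in_labels_def Pos_iff ht_linear)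

lemma hless_full: "hl g u w \<Longrightarrow> hl 0 u w"
  unfolding hless_def[of _ _ _ g]
  by (induction rule: tranclp_induct) (blast intro: hedge_hless hless_hedge hedge_full)+

lemma GKM_full: "P \<in> GK 0 \<Longrightarrow> P \<in> GK g"
  unfolding GKM_def using hedge_full by blast

text \<open>The equation \<open>inv w \<alpha> = - \<gamma>\<close> has the single solution
  \<open>- w \<gamma>\<close>, which is a positive root here.\<close>

lemma in_labels_gamma_neg:
  assumes w: "w \<in> W" and neg: "ht (w \<gamma>) < 0"
  shows "in_labels 0 w = insert (- w \<gamma>) (in_labels \<gamma> w)" "- w \<gamma> \<notin> in_labels \<gamma> w"
proof -
  have i: "inv w (- w \<gamma>) = - \<gamma>" using w by (simp add: weyl_inv_uminus)
  have "- w \<gamma> \<in> Pos"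
    using neg uminus_root[OF weyl_props(4)[OF w gamma_root(1)]] by (simp add: Pos_iff ht_linear)
  moreover have "\<alpha> = - w \<gamma>" if "inv w \<alpha> = - \<gamma>" for \<alpha>
    using that w by (metis inv_weyl(2) weyl_uminus)
  moreover have "ht (inv w (- w \<gamma>)) < 0" unfolding i ht_linear using gamma_root by simp
  ultimately show "in_labels 0 w = insert (- w \<gamma>) (in_labels \<gamma> w)"
    unfolding in_labels_0[OF w] in_labels_def[of \<gamma>] by blast
  show "- w \<gamma> \<notin> in_labels \<gamma> w" using i by (simp add: in_labels_def)
qed

lemma in_labels_gamma_pos:
  assumes w: "w \<in> W" and pos: "ht (w \<gamma>) > 0"
  shows "in_labels \<gamma> w = in_labels 0 w"
proof -
  have "inv w \<alpha> \<noteq> - \<gamma>" if "\<alpha> \<in> Pos" for \<alpha>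
  proof
    assume "inv w \<alpha> = - \<gamma>"
    then have "\<alpha> = - w \<gamma>" using w by (metis inv_weyl(2) weyl_uminus)
    then show False using that pos by (simp add: Pos_iff ht_linear)
  qed
  then show ?thesis unfolding in_labels_0[OF w] in_labels_def[of \<gamma>] by blast
qed

lemma card_in_labels_gamma: "w \<in> W \<Longrightarrow> N w \<le> Suc (card (in_labels \<gamma> w))"
  using in_labels_gamma_neg[of w] in_labels_gamma_pos[of w] finite_in_labels[of \<gamma> w]
    ht_root(1)[OF weyl_props(4)[OF _ gamma_root(1)], of w]
  by (cases "ht (w \<gamma>) > 0") (auto simp: N_def)

lemma flow_up_neg:
  assumes w: "w \<in> W" and neg: "ht (w \<gamma>) < 0"
  shows "\<exists>F. flow_up \<Phi> alpha k \<gamma> w F"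
proof -
  obtain P where "flow_up \<Phi> alpha k 0 w P" using schubert_class_exists[OF w] ..
  then have P: "P \<in> GK 0" "\<And>y. y \<in> W \<Longrightarrow> homogeneous (card (in_labels 0 w)) (P y)"
    "P w = (\<Prod>\<alpha>\<in>in_labels 0 w. L \<alpha>)" "\<And>y. y \<in> W \<Longrightarrow> P y \<noteq> 0 \<Longrightarrow> y = w \<or> hl 0 w y"
    unfolding flow_up_iff[OF w] by blast+
  have supp: "ht (y \<gamma>) < 0" if "y \<in> W" "P y \<noteq> 0" for y
    using P(4)[OF that] hless_neg(2) neg by blast
  let ?b = "\<lambda>y. - y \<gamma>"
  have root: "?b y \<in> \<Phi>" if "y \<in> W" for y
    using that uminus_root weyl_props(4) gamma_root by blast
  have dvd: "L (?b y) dvd P y" if y: "y \<in> W" for y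
  proof (cases "P y = 0")
    case False
    \<comment> \<open>This is \<open>y \<circ> refl \<gamma>\<close>. It sends
      \<open>\<gamma>\<close> to a positive root, so it lies off the support of
      \<open>P\<close>.\<close>
    let ?u = "refl (?b y) \<circ> y"
    have u: "?u \<in> W" using y root refl_weyl weyl_comp by blast
    have "?u \<gamma> = - y \<gamma>" by simp
    then have "P ?u = 0" using supp[OF u] supp[OF y False] ht_linear(4)[of "y \<gamma>"] by fastforce
    moreover have "L (?b y) dvd P ?u - P y"
      using GKM_refl_dvd[OF P(1) y root[OF y]] root_nz[OF weyl_inv_root[OF y root[OF y]]] by simp
    ultimately show ?thesis by simp
  qed simp
  define F where "F y = (if y \<in> W then SOME q. P y = L (?b y) * q else 0)" for y
  have F: "L (?b y) * F y = P y" if "y \<in> W" for y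
  proof -
    have "\<exists>q. P y = L (?b y) * q" using dvd[OF that] unfolding dvd_def .
    from someI_ex[OF this] show ?thesis using that by (simp add: F_def)
  qed
  have FG: "F \<in> GK \<gamma>"
    unfolding GKM_iff
  proof (intro conjI ballI allI impI)
    fix y show "y \<notin> W \<Longrightarrow> F y = 0" by (simp add: F_def)
  next
    fix y assume y: "y \<in> W"
    have "in_RDelta k (L (?b y) * F y)" unfolding F[OF y] by (rule GKM_in_RDelta[OF P(1)])
    then show "in_RDelta k (F y)" by (rule in_RDelta_cancel[OF in_RDelta_L L_root_nz[OF root[OF y]]])
  next
    fix y \<alpha> assume y: "y \<in> W" and a: "\<alpha> \<in> in_labels \<gamma> y"
    let ?u = "refl \<alpha> \<circ> y"
    have \<alpha>: "\<alpha> \<in> \<Phi>" "ht (inv y \<alpha>) < 0" "inv y \<alpha> \<noteq> - \<gamma>" using a by (auto simp: in_labels_def Pos_iff)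
    have u: "?u \<in> W" using weyl_comp refl_weyl \<alpha> y by blast
    have "L \<alpha> dvd P ?u - P y"
      using GKM_refl_dvd[OF P(1) y \<alpha>(1)] root_nz[OF weyl_inv_root[OF y \<alpha>(1)]] by simp
    then have "L \<alpha> dvd L (?b y) * F y - L (?b ?u) * F ?u"
      unfolding F[OF y] F[OF u] by (rule dvd_diff_swap)
    moreover have "L \<alpha> dvd L (?b y) - L (?b ?u)"
      by (simp add: refl_def L_uminus L_diff L_scaleR)
    \<comment> \<open>Divisibility would force \<open>inv y \<alpha>\<close> to be
      \<open>- \<gamma>\<close>, which is the excluded edge, or \<open>\<gamma>\<close>, which is
      not negative.\<close>
    moreover have "\<not> L \<alpha> dvd L (?b y)"
    proof
      assume "L \<alpha> dvd L (?b y)"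
      then have "y \<gamma> = \<alpha> \<or> y \<gamma> = - \<alpha>"
        using L_dvd_L_root[OF \<alpha>(1) root[OF y]] by (metis minus_minus)
      then have "\<gamma> = inv y \<alpha> \<or> \<gamma> = - inv y \<alpha>" using y by (metis inv_weyl(1) weyl_inv_uminus)
      then show False using \<alpha> gamma_root by auto
    qed
    ultimately have "L \<alpha> dvd F y - F ?u" using dvd_quotient_diff prime_elem_L_root[OF \<alpha>(1)] by blast
    then show "L \<alpha> dvd F ?u - F y" by (rule dvd_diff_swap)
  qed
  have card: "card (in_labels 0 w) = 1 + card (in_labels \<gamma> w)"
    using in_labels_gamma_neg[OF w neg] finite_in_labels by simp
  have hom: "homogeneous (card (in_labels \<gamma> w)) (F y)" if y: "y \<in> W" for y
    by (rule homogeneous_cancel[OF homogeneous_L L_root_nz[OF root[OF y]]])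
       (use P(2)[OF y] in \<open>simp only: F[OF y] card\<close>)
  have "L (?b w) * F w = L (?b w) * (\<Prod>\<alpha>\<in>in_labels \<gamma> w. L \<alpha>)"
    unfolding F[OF w] P(3) using in_labels_gamma_neg[OF w neg] finite_in_labels by simp
  then have "F w = (\<Prod>\<alpha>\<in>in_labels \<gamma> w. L \<alpha>)" using L_root_nz[OF root[OF w]] by simp
  moreover have "y = w \<or> hl \<gamma> w y" if "y \<in> W" "F y \<noteq> 0" for y
  proof -
    have "P y \<noteq> 0" using F[OF that(1)] that(2) L_root_nz[OF root[OF that(1)]] by (metis mult_eq_0_iff)
    then show ?thesis using P(4) that(1) hless_neg(1) neg by blast
  qed
  ultimately have "flow_up \<Phi> alpha k \<gamma> w F"
    unfolding flow_up_iff[OF w] using FG hom by blast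
  then show ?thesis by (rule exI[of _ F])
qed

text \<open>For \<open>w \<gamma> > 0\<close> the Schubert class has the right degree and leading term, but its support may
  reach the cover \<open>w s\<^sub>\<gamma>\<close> of \<open>w\<close>, whose edge was removed; the class at \<open>w s\<^sub>\<gamma>\<close> corrects that.\<close>

lemma flow_up_pos:
  assumes w: "w \<in> W" and pos: "ht (w \<gamma>) > 0"
  shows "\<exists>F. flow_up \<Phi> alpha k \<gamma> w F"
proof -
  obtain P where Pf: "flow_up \<Phi> alpha k 0 w P" using schubert_class_exists[OF w] ..
  then have P: "P \<in> GK 0" "\<And>y. y \<in> W \<Longrightarrow> homogeneous (N w) (P y)"
    "P w = (\<Prod>\<alpha>\<in>in_labels 0 w. L \<alpha>)" "\<And>y. y \<in> W \<Longrightarrow> P y \<noteq> 0 \<Longrightarrow> y = w \<or> hl 0 w y"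
    unfolding flow_up_iff[OF w] N_def by blast+
  let ?\<beta> = "w \<gamma>"
  have \<beta>: "?\<beta> \<in> \<Phi>" "?\<beta> \<in> Pos" using w weyl_props(4) gamma_root pos by (auto simp: Pos_iff)
  define z where "z = refl ?\<beta> \<circ> w"
  have z: "z \<in> W" unfolding z_def using weyl_comp refl_weyl \<beta> w by blast
  have inv_z: "inv z ?\<beta> = - \<gamma>"
    unfolding z_def using inv_comp_refl[OF w \<beta>(1)] w by (simp add: weyl_inv_uminus)
  have wz: "hedge \<Phi> alpha k 0 w z ?\<beta>"
    using \<beta> z inv_z gamma_root by (auto simp: hedge_iff in_labels_0 ht_linear z_def)
  \<comment> \<open>Only a \<open>z\<close> one step above \<open>w\<close> needs a correction;
    otherwise \<open>P\<close> itself serves as \<open>G\<close>.\<close>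
  have "\<exists>G. G \<in> GK \<gamma> \<and> (\<forall>y\<in>W. homogeneous (N w) (G y)) \<and> G w = P w
      \<and> (\<forall>y\<in>W. G y \<noteq> 0 \<longrightarrow> y = w \<or> hl 0 w y) \<and> (N z = Suc (N w) \<longrightarrow> G z = 0)"
  proof (cases "N z = Suc (N w)")
    case False
    then show ?thesis using P GKM_full by blast
  next
    case True
    have neg: "ht (z \<gamma>) < 0" using pos by (simp add: z_def ht_linear)
    obtain F where Ff: "flow_up \<Phi> alpha k \<gamma> z F" using flow_up_neg[OF z neg] ..
    then have F: "F \<in> GK \<gamma>" "\<And>y. y \<in> W \<Longrightarrow> homogeneous (card (in_labels \<gamma> z)) (F y)"
      "F z = (\<Prod>\<alpha>\<in>in_labels \<gamma> z. L \<alpha>)" "\<And>y. y \<in> W \<Longrightarrow> F y \<noteq> 0 \<Longrightarrow> y = z \<or> hl \<gamma> z y"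
      unfolding flow_up_iff[OF z] by blast+
    have card: "card (in_labels \<gamma> z) = N w"
      using True in_labels_gamma_neg[OF z neg] finite_in_labels by (simp add: N_def)
    \<comment> \<open>Lower neighbours of \<open>z\<close> have \<open>N\<close> at most
      \<open>N w\<close>, so \<open>P\<close> could be nonzero only at \<open>w\<close>; but the
      edge from \<open>w\<close> to \<open>z\<close> is the removed one.\<close>
    have "P (refl \<alpha> \<circ> z) = 0" if a: "\<alpha> \<in> in_labels \<gamma> z" for \<alpha>
    proof (rule ccontr)
      assume nz: "P (refl \<alpha> \<circ> z) \<noteq> 0"
      have e: "hedge \<Phi> alpha k \<gamma> (refl \<alpha> \<circ> z) z \<alpha>" using a z by (simp add: hedge_iff)
      have "N (refl \<alpha> \<circ> z) \<le> N w" using hedge_N_less[OF e] True by linarith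
      then have "refl \<alpha> \<circ> z = w" using flow_up_low[OF w Pf hedge_weyl(1)[OF e]] nz by blast
      moreover have "w = refl ?\<beta> \<circ> z" by (simp add: z_def)
      ultimately have "refl \<alpha> \<circ> z = refl ?\<beta> \<circ> z" by (rule trans)
      then have "refl \<alpha> (z (inv z x)) = refl ?\<beta> (z (inv z x))" for x by (rule comp_eq_dest)
      then have "refl \<alpha> x = refl ?\<beta> x" for x unfolding inv_weyl(2)[OF z] .
      then have "refl \<alpha> = refl ?\<beta>" by blast
      then have "\<alpha> = ?\<beta>" using refl_inj_Pos \<beta> hedge_weyl(3)[OF e] by blast
      then show False using a inv_z by (simp add: in_labels_def)
    qed
    then have "(\<Prod>\<alpha>\<in>in_labels \<gamma> z. L \<alpha>) dvd P z" using prod_in_labels_dvd GKM_full P(1) z by blast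
    then obtain c where c: "P z = (\<Prod>\<alpha>\<in>in_labels \<gamma> z. L \<alpha>) * c" unfolding dvd_def by blast
    \<comment> \<open>\<open>z\<close> has exactly \<open>N w\<close> remaining labels, so their
      product already has the degree of \<open>P z\<close>.\<close>
    have c_hom: "homogeneous 0 c"
      using homogeneous_cancel[OF prod_in_labels(1,3)[of \<gamma> z], of 0 c] P(2)[OF z] c card by simp
    have c_R: "in_RDelta k c"
      using in_RDelta_cancel[OF prod_in_labels(2,3)[of \<gamma> z], of c] GKM_in_RDelta[OF P(1), of z] c by simp
    define G where "G y = P y - c * F y" for y
    have "G \<in> GK \<gamma>" unfolding G_def using GKM_diff GKM_smult GKM_full P(1) F(1) c_R by blast
    moreover have "homogeneous (N w) (G y)" if "y \<in> W" for y
      unfolding G_def using homogeneous_diff[OF P(2)[OF that]] homogeneous_mult[OF c_hom F(2)[OF that]]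
      by (simp add: card)
    moreover have "F w = 0"
    proof (rule ccontr)
      assume "F w \<noteq> 0"
      then have "w = z" using flow_up_low[OF z Ff w] True by simp
      then show False using True by simp
    qed
    then have "G w = P w" by (simp add: G_def)
    moreover have "y = w \<or> hl 0 w y" if "y \<in> W" "G y \<noteq> 0" for y
    proof -
      have "P y \<noteq> 0 \<or> F y \<noteq> 0" using that(2) by (auto simp: G_def)
      moreover have "hl 0 w y" if "F y \<noteq> 0"
      proof -
        have "y = z \<or> hl 0 z y" using F(4)[OF \<open>y \<in> W\<close> that] hless_full by blast
        then show ?thesis using hedge_hless[OF wz] unfolding hless_def by (metis tranclp_trans)
      qed
      ultimately show ?thesis using P(4)[OF \<open>y \<in> W\<close>] by blast
    qed
    moreover have "G z = 0" by (simp add: G_def c F(3))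
    ultimately show ?thesis by blast
  qed
  then obtain G where G: "G \<in> GK \<gamma>" "\<And>y. y \<in> W \<Longrightarrow> homogeneous (N w) (G y)" "G w = P w"
    "\<And>y. y \<in> W \<Longrightarrow> G y \<noteq> 0 \<Longrightarrow> y = w \<or> hl 0 w y" "N z = Suc (N w) \<Longrightarrow> G z = 0"
    by blast
  have low: "y = w \<or> hl \<gamma> w y" if y: "y \<in> W" "G y \<noteq> 0" "card (in_labels \<gamma> y) \<le> N w" for y
  proof (rule ccontr)
    assume n: "\<not> ?thesis"
    then have less: "hl 0 w y" using G(4) y by blast
    \<comment> \<open>At most one incoming edge was removed at \<open>y\<close>, so \<open>y\<close>
      lies just one level above \<open>w\<close> and the Bruhat path is a single edge.\<close>
    have Ny: "N y = Suc (N w)" using hless_N_less[OF less] card_in_labels_gamma[OF y(1)] y(3) by simp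
    obtain \<alpha> where e: "hedge \<Phi> alpha k 0 w y \<alpha>"
      using less unfolding hless_def
    proof (cases rule: tranclp.cases)
      case (trancl_into_trancl u)
      then have "N w < N u" "N u < N y"
        using hless_N_less[of 0 w u] hedge_N_less unfolding hless_def by blast+
      then show ?thesis using Ny by simp
    qed (use that in blast)
    note h = hedge_weyl[OF e]
    \<comment> \<open>That edge must be the removed one, which ends at \<open>z\<close>, where
      \<open>G\<close> was made to vanish.\<close>
    have "\<not> hedge \<Phi> alpha k \<gamma> w y \<alpha>" using n hedge_hless by blast
    then have "inv y \<alpha> = - \<gamma>" using e by (auto simp: hedge_iff in_labels_def)
    then have "inv w \<alpha> = \<gamma>"
      using inv_comp_refl[OF h(2,4), of \<alpha>] e by (simp add: hedge_iff weyl_inv_uminus)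
    then have "\<alpha> = ?\<beta>" using w by (metis inv_weyl(2))
    then have "y = z" using h(5) by (simp add: z_def)
    then show False using G(5) Ny y(2) by simp
  qed
  have "y = w \<or> hl \<gamma> w y" if "y \<in> W" "G y \<noteq> 0" for y
    using support_hless[OF G(1,2) low that] .
  then have "flow_up \<Phi> alpha k \<gamma> w G"
    unfolding flow_up_iff[OF w] using G(1,2,3) P(3) in_labels_gamma_pos[OF w pos] by (simp add: N_def)
  then show ?thesis by (rule exI[of _ G])
qed

lemma flow_up_exists: "w \<in> W \<Longrightarrow> \<exists>F. flow_up \<Phi> alpha k \<gamma> w F"
  using flow_up_neg flow_up_pos ht_root(1)[OF weyl_props(4)[OF _ gamma_root(1)]]
  by (metis linorder_neqE_linordered_idom)

end

section \<open>Divided difference operators\<close>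

locale flow_up_basis = root_base \<Phi> alpha k
    for \<Phi> :: "'v::euclidean_space set" and alpha :: "nat \<Rightarrow> 'v" and k :: nat +
  fixes g :: 'v and F :: "('v \<Rightarrow> 'v) \<Rightarrow> (('v \<Rightarrow> 'v) \<Rightarrow> rpoly)"
  assumes flow: "\<And>w. w \<in> W \<Longrightarrow> flow_up \<Phi> alpha k g w (F w)"
begin

lemma F_GKM: "w \<in> W \<Longrightarrow> F w \<in> GK g"
  using flow flow_up_iff by blast

lemma F_diag: "w \<in> W \<Longrightarrow> F w w = (\<Prod>\<alpha>\<in>in_labels g w. L \<alpha>)"
  using flow flow_up_iff by blast

lemma F_low: "w \<in> W \<Longrightarrow> y \<in> W \<Longrightarrow> N y \<le> N w \<Longrightarrow> y \<noteq> w \<Longrightarrow> F w y = 0"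
  using flow_up_low[OF _ flow] by blast

definition comb :: "(('v \<Rightarrow> 'v) \<Rightarrow> rpoly) \<Rightarrow> (('v \<Rightarrow> 'v) \<Rightarrow> rpoly)" where
  "comb c y = (\<Sum>w\<in>W. c w * F w y)"

text \<open>Elimination by levels of \<open>N\<close>. On the lowest level \<open>n\<close> the
  class vanishes at all lower neighbours, so \<open>F w w\<close> divides \<open>P w\<close>.
  Subtracting these multiples clears the level, and triangularity keeps lower levels zero and
  different elements of one level independent.\<close>

lemma expand_above:
  assumes "P \<in> GK g" and "\<And>y. y \<in> W \<Longrightarrow> N y < n \<Longrightarrow> P y = 0"
  shows "\<exists>c. (\<forall>w\<in>W. in_RDelta k (c w)) \<and> P = comb c"
  using assms
proof (induction "Suc (card Pos) - n" arbitrary: n P rule: less_induct)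
  case less
  show ?case
  proof (cases "n > card Pos")
    case True
    have "P y = 0" for y
    proof (cases "y \<in> W")
      case True
      have "N y \<le> card Pos" unfolding N_def by (rule card_mono) (auto simp: finite_Pos in_labels_def)
      then show ?thesis using less.prems(2) True \<open>n > card Pos\<close> by simp
    next
      case False
      then show ?thesis using less.prems(1) unfolding GKM_iff by blast
    qed
    then show ?thesis by (intro exI[of _ "\<lambda>_. 0"]) (auto simp: comb_def)
  next
    case False
    define A where "A = {w\<in>W. N w = n}"
    have A: "finite A" "A \<subseteq> W" using finite_weyl by (auto simp: A_def)
    have "\<exists>q. P w = F w w * q" if "w \<in> A" for w
    proof -
      have w: "w \<in> W" "N w = n" using that by (auto simp: A_def)
      have "P (refl \<alpha> \<circ> w) = 0" if a: "\<alpha> \<in> in_labels g w" for \<alpha>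
      proof -
        have e: "hedge \<Phi> alpha k g (refl \<alpha> \<circ> w) w \<alpha>" using a w by (simp add: hedge_iff)
        then show ?thesis using less.prems(2) hedge_weyl(1)[OF e] hedge_N_less[OF e] w(2) by blast
      qed
      then have "F w w dvd P w" unfolding F_diag[OF w(1)] using prod_in_labels_dvd less.prems(1) w(1) by blast
      then show ?thesis unfolding dvd_def .
    qed
    then obtain q where q: "\<And>w. w \<in> A \<Longrightarrow> P w = F w w * q w" by metis
    have qR: "in_RDelta k (q w)" if "w \<in> A" for w
    proof -
      have w: "w \<in> W" using that A by blast
      show ?thesis
        using in_RDelta_cancel[OF prod_in_labels(2,3)] GKM_in_RDelta[OF less.prems(1), of w]
        unfolding q[OF that] F_diag[OF w] by blast
    qed
    define Q where "Q y = P y - (\<Sum>w\<in>A. q w * F w y)" for y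
    have "(\<lambda>y. \<Sum>w\<in>A. q w * F w y) \<in> GK g"
      using A(2) qR by (intro GKM_sum GKM_smult F_GKM) auto
    then have QG: "Q \<in> GK g" unfolding Q_def using GKM_diff less.prems(1) by blast
    have Q0: "Q y = 0" if y: "y \<in> W" "N y < Suc n" for y
    proof (cases "y \<in> A")
      case True
      have "(\<Sum>w\<in>A. q w * F w y) = (\<Sum>w\<in>A. if w = y then q y * F y y else 0)"
        using A y F_low by (intro sum.cong) (auto simp: A_def)
      then show ?thesis using True A(1) q[OF True] by (simp add: Q_def)
    next
      case False
      then have "N y < n" using y by (auto simp: A_def)
      moreover have "F w y = 0" if "w \<in> A" for w
        using that \<open>N y < n\<close> F_low[of w y] y(1) by (auto simp: A_def)
      ultimately show ?thesis using less.prems(2) y(1) by (simp add: Q_def)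
    qed
    have "Suc (card Pos) - Suc n < Suc (card Pos) - n" using False by simp
    then obtain c where c: "\<forall>w\<in>W. in_RDelta k (c w)" "Q = comb c"
      using less.hyps QG Q0 by blast
    define d where "d w = c w + (if w \<in> A then q w else 0)" for w
    have "P y = comb d y" for y
    proof -
      have "comb d y = (\<Sum>w\<in>W. c w * F w y + (if w \<in> A then q w * F w y else 0))"
        unfolding comb_def d_def by (intro sum.cong) (auto simp: distrib_right)
      also have "\<dots> = comb c y + (\<Sum>w\<in>W \<inter> A. q w * F w y)"
        using finite_weyl by (simp add: sum.distrib comb_def sum.inter_restrict)
      also have "W \<inter> A = A" using A by blast
      also have "comb c y + (\<Sum>w\<in>A. q w * F w y) = P y" unfolding c(2)[symmetric] by (simp add: Q_def)
      finally show ?thesis by simp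
    qed
    moreover have "in_RDelta k (d w)" if "w \<in> W" for w
      unfolding d_def using c(1) that qR by (intro in_RDelta_add) auto
    ultimately show ?thesis by (intro exI[of _ d]) auto
  qed
qed

text \<open>At \<open>w\<close>, coefficients of smaller \<open>N\<close> vanish by induction and
  the other off-diagonal classes vanish by triangularity; the diagonal value is nonzero.\<close>

lemma comb_eq_zero:
  assumes "\<And>y. y \<in> W \<Longrightarrow> comb c y = 0" and "w \<in> W"
  shows "c w = 0"
  using assms(2)
proof (induction "N w" arbitrary: w rule: less_induct)
  case less
  have "c v * F v w = (if v = w then c w * F w w else 0)" if "v \<in> W" for v
  proof (cases "N v < N w")
    case True
    then show ?thesis using less.hyps that by auto
  next
    case False
    then show ?thesis using F_low[OF that less.prems] by auto
  qed
  then have "comb c w = (\<Sum>v\<in>W. if v = w then c w * F w w else 0)"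
    unfolding comb_def by (rule sum.cong[OF HOL.refl])
  then have "c w * F w w = 0" using assms(1)[OF less.prems] less.prems finite_weyl by simp
  then show ?case using prod_in_labels(3) F_diag[OF less.prems] by simp
qed

definition cf :: "(('v \<Rightarrow> 'v) \<Rightarrow> rpoly) \<Rightarrow> ('v \<Rightarrow> 'v) \<Rightarrow> rpoly" where
  "cf P = (SOME c. (\<forall>w\<in>W. in_RDelta k (c w)) \<and> P = comb c)"

lemma cf:
  assumes "P \<in> GK g"
  shows "w \<in> W \<Longrightarrow> in_RDelta k (cf P w)" "comb (cf P) = P"
proof -
  have "\<exists>c. (\<forall>w\<in>W. in_RDelta k (c w)) \<and> P = comb c"
    by (rule expand_above[OF assms, of 0]) simp
  from someI_ex[OF this] show "w \<in> W \<Longrightarrow> in_RDelta k (cf P w)" "comb (cf P) = P"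
    unfolding cf_def by auto
qed

lemma cf_unique:
  assumes "P \<in> GK g" "P = comb c" "w \<in> W"
  shows "cf P w = c w"
proof -
  have "comb (\<lambda>w. cf P w - c w) y = 0" for y
    using fun_cong[OF cf(2)[OF assms(1)], of y] fun_cong[OF assms(2), of y]
    by (simp add: comb_def left_diff_distrib sum_subtractf)
  then show ?thesis using comb_eq_zero[of "\<lambda>w. cf P w - c w"] assms(3) by simp
qed

section \<open>Linear extension from the basis\<close>

definition extend :: "(('v \<Rightarrow> 'v) \<Rightarrow> (('v \<Rightarrow> 'v) \<Rightarrow> rpoly)) \<Rightarrow>
    (('v \<Rightarrow> 'v) \<Rightarrow> rpoly) \<Rightarrow> (('v \<Rightarrow> 'v) \<Rightarrow> rpoly)" where
  "extend T P y = (\<Sum>w\<in>W. cf P w * T w y)"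

lemma module_hom_extend:
  assumes T: "\<And>w. w \<in> W \<Longrightarrow> T w \<in> GK g"
  shows "module_hom \<Phi> alpha k g (extend T)"
  unfolding module_hom_def
proof (intro conjI ballI allI impI)
  fix P assume P: "P \<in> GK g"
  show "extend T P \<in> GK g"
    unfolding extend_def using cf(1)[OF P] T by (intro GKM_sum GKM_smult)
  fix Q assume Q: "Q \<in> GK g"
  have "cf (\<lambda>w. P w + Q w) w = cf P w + cf Q w" if "w \<in> W" for w
  proof (rule cf_unique[OF GKM_add[OF P Q] _ that])
    show "(\<lambda>w. P w + Q w) = comb (\<lambda>w. cf P w + cf Q w)"
      using fun_cong[OF cf(2)[OF P]] fun_cong[OF cf(2)[OF Q]]
      by (simp add: comb_def distrib_right sum.distrib fun_eq_iff)
  qed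
  then show "extend T (\<lambda>w. P w + Q w) = (\<lambda>w. extend T P w + extend T Q w)"
    by (simp add: extend_def fun_eq_iff distrib_right sum.distrib)
next
  fix P f assume P: "P \<in> GK g" and f: "in_RDelta k f"
  have "cf (\<lambda>w. f * P w) w = f * cf P w" if "w \<in> W" for w
  proof (rule cf_unique[OF GKM_smult[OF P f] _ that])
    show "(\<lambda>w. f * P w) = comb (\<lambda>w. f * cf P w)"
      using fun_cong[OF cf(2)[OF P], symmetric]
      by (simp add: comb_def mult.assoc sum_distrib_left[symmetric] fun_eq_iff)
  qed
  then show "extend T (\<lambda>w. f * P w) = (\<lambda>w. f * extend T P w)"
    by (simp add: extend_def fun_eq_iff mult.assoc sum_distrib_left)
qed

lemma extend_F:
  assumes "w \<in> W"
  shows "extend T (F w) = T w"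
proof
  fix y
  have "cf (F w) v = (if v = w then 1 else 0)" if "v \<in> W" for v
  proof (rule cf_unique[OF F_GKM[OF assms] _ that])
    show "F w = comb (\<lambda>v. if v = w then 1 else 0)"
      using assms finite_weyl
      by (intro ext) (simp add: comb_def if_distrib[of "\<lambda>x. x * _"] cong: if_cong)
  qed
  then have "extend T (F w) y = (\<Sum>v\<in>W. if v = w then T w y else 0)"
    unfolding extend_def by (intro sum.cong) auto
  then show "extend T (F w) y = T w y" using assms finite_weyl by simp
qed

lemma module_hom_zero:
  assumes "module_hom \<Phi> alpha k g T"
  shows "T (\<lambda>_. 0) = (\<lambda>_. 0)"
proof -
  have "\<forall>P\<in>GK g. \<forall>f. in_RDelta k f \<longrightarrow> T (\<lambda>w. f * P w) = (\<lambda>w. f * T P w)"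
    using assms unfolding module_hom_def by blast
  from this[rule_format, OF GKM_zero in_RDelta_0] show ?thesis by simp
qed

lemma module_hom_eqI:
  assumes S: "module_hom \<Phi> alpha k g S" and T: "module_hom \<Phi> alpha k g T"
    and eq: "\<And>w. w \<in> W \<Longrightarrow> S (F w) = T (F w)" and P: "P \<in> GK g"
  shows "S P = T P"
proof -
  \<comment> \<open>Additivity is given only for two summands in the GKM ring, so the finite sum is
    built up with every partial sum kept in the ring.\<close>
  have hom: "T (\<lambda>y. \<Sum>w\<in>A. cf P w * F w y) = (\<lambda>y. \<Sum>w\<in>A. cf P w * T (F w) y)"
    if T: "module_hom \<Phi> alpha k g T" and "finite A" "A \<subseteq> W" for T A
    using that(2,3)
  proof (induction A rule: finite_induct)
    case empty
    show ?case using module_hom_zero[OF T] by simp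
  next
    case (insert v A)
    have v: "F v \<in> GK g" "in_RDelta k (cf P v)" using insert.prems F_GKM cf(1)[OF P] by auto
    have A: "(\<lambda>y. \<Sum>w\<in>A. cf P w * F w y) \<in> GK g"
      using insert.prems cf(1)[OF P] F_GKM by (intro GKM_sum GKM_smult) auto
    have "\<forall>P\<in>GK g. \<forall>Q\<in>GK g. T (\<lambda>w. P w + Q w) = (\<lambda>w. T P w + T Q w)"
      using T unfolding module_hom_def by blast
    from this[rule_format, OF GKM_smult[OF v] A]
    have "T (\<lambda>y. cf P v * F v y + (\<Sum>w\<in>A. cf P w * F w y))
        = (\<lambda>y. T (\<lambda>y. cf P v * F v y) y + T (\<lambda>y. \<Sum>w\<in>A. cf P w * F w y) y)" .
    moreover have "T (\<lambda>y. cf P v * F v y) = (\<lambda>y. cf P v * T (F v) y)"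
      using T v unfolding module_hom_def by blast
    ultimately show ?case using insert by simp
  qed
  have P_eq: "P = (\<lambda>y. \<Sum>w\<in>W. cf P w * F w y)"
    using cf(2)[OF P] by (simp add: comb_def fun_eq_iff)
  have "S P = (\<lambda>y. \<Sum>w\<in>W. cf P w * S (F w) y)"
    by (subst P_eq) (rule hom[OF S finite_weyl subset_refl])
  also have "\<dots> = (\<lambda>y. \<Sum>w\<in>W. cf P w * T (F w) y)" using eq by simp
  also have "\<dots> = T P"
    by (subst (2) P_eq) (rule hom[OF T finite_weyl subset_refl, symmetric])
  finally show ?thesis .
qed

section \<open>The operators and the nil-Coxeter relations\<close>

definition ddiff :: "nat \<Rightarrow> (('v \<Rightarrow> 'v) \<Rightarrow> rpoly) \<Rightarrow> (('v \<Rightarrow> 'v) \<Rightarrow> rpoly)" where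
  "ddiff i = extend (\<lambda>w. if ht (inv w (alpha i)) < 0 then F (refl (alpha i) \<circ> w) else (\<lambda>_. 0))"

lemma ddiff_F: "w \<in> W \<Longrightarrow>
    ddiff i (F w) = (if ht (inv w (alpha i)) < 0 then F (refl (alpha i) \<circ> w) else (\<lambda>_. 0))"
  unfolding ddiff_def by (rule extend_F)

lemma module_hom_ddiff: "i < k \<Longrightarrow> module_hom \<Phi> alpha k g (ddiff i)"
  unfolding ddiff_def
  by (rule module_hom_extend) (auto intro: F_GKM GKM_zero weyl_comp weyl_simple)

lemma op_word_Cons: "op_word D (i # is) P = D i (op_word D is P)"
  by (simp add: op_word_def)

lemma word_Cons: "word alpha (i # is) = refl (alpha i) \<circ> word alpha is"
  by (simp add: word_def)

lemma module_hom_op_word: "set is \<subseteq> {..<k} \<Longrightarrow> module_hom \<Phi> alpha k g (op_word ddiff is)"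
proof (induction "is")
  case Nil
  show ?case by (simp add: module_hom_def op_word_def)
next
  case (Cons i js)
  have "module_hom \<Phi> alpha k g (ddiff i)" "module_hom \<Phi> alpha k g (op_word ddiff js)"
    using Cons module_hom_ddiff by auto
  then show ?case unfolding module_hom_def op_word_Cons by simp
qed

lemma word_weyl: "set is \<subseteq> {..<k} \<Longrightarrow> word alpha is \<in> W"
proof (induction "is")
  case Nil
  show ?case using weyl.weyl_id[of alpha k] by (simp add: word_def id_def)
next
  case (Cons i js)
  then have "i < k" "word alpha js \<in> W" by auto
  then show ?case unfolding word_Cons by (intro weyl_comp weyl_simple)
qed

text \<open>On the basis the operator word depends only on the product and the length of the word.
  The inequality is carried along because an ascent makes the left side exceed \<open>N w\<close> by
  at least two, and equality can then not be regained. The additive form avoids truncated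
  subtraction.\<close>

lemma op_word_F:
  "set is \<subseteq> {..<k} \<Longrightarrow> w \<in> W \<Longrightarrow> N w \<le> N (word alpha is \<circ> w) + length is \<and>
    op_word ddiff is (F w) =
      (if N (word alpha is \<circ> w) + length is = N w then F (word alpha is \<circ> w) else (\<lambda>_. 0))"
proof (induction "is")
  case Nil
  show ?case by (simp add: op_word_def word_def)
next
  case (Cons i js)
  define x where "x = word alpha js \<circ> w"
  have i: "i < k" and x: "x \<in> W"
    using Cons.prems weyl_comp word_weyl by (auto simp: x_def)
  define z where "z = refl (alpha i) \<circ> x"
  have z: "word alpha (i # js) \<circ> w = z"
    unfolding x_def z_def word_Cons by (simp only: comp_assoc)
  have "set js \<subseteq> {..<k}" using Cons.prems(1) by simp
  then have IH: "N w \<le> N x + length js"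
    "op_word ddiff js (F w) = (if N x + length js = N w then F x else (\<lambda>_. 0))"
    using Cons.IH[OF _ Cons.prems(2)] unfolding x_def by blast+
  have "ht (inv x (alpha i)) \<noteq> 0"
    using ht_root(1) weyl_inv_root[OF x] alpha_root[OF i] by blast
  then consider "ht (inv x (alpha i)) < 0" "N x = Suc (N z)"
    | "ht (inv x (alpha i)) > 0" "N z = Suc (N x)"
    using N_simple_left[OF x i, folded z_def] N_simple_left'[OF x i, folded z_def] by fastforce
  then show ?case
    unfolding z op_word_Cons IH(2)
    using IH(1) ddiff_F[OF x, of i, folded z_def] module_hom_zero[OF module_hom_ddiff[OF i]] by cases auto
qed

text \<open>By minimality reduced expressions have equal length, so both operator words agree on the
  basis.\<close>

lemma op_word_reduced:
  assumes "reduced_expr alpha k is w" "reduced_expr alpha k js w" "P \<in> GK g"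
  shows "op_word ddiff is P = op_word ddiff js P"
proof -
  have r: "set is \<subseteq> {..<k}" "set js \<subseteq> {..<k}" "word alpha is = word alpha js" "length is = length js"
    using assms(1,2) unfolding reduced_expr_def by (auto intro: order_antisym)
  show ?thesis
    by (rule module_hom_eqI[OF module_hom_op_word[OF r(1)] module_hom_op_word[OF r(2)] _ assms(3)])
       (simp add: op_word_F r)
qed

end

theorem theorem3p3:
  fixes \<Phi> :: "'v::euclidean_space set" and alpha :: "nat \<Rightarrow> 'v" and k :: nat and \<gamma> :: 'v
  assumes "root_system \<Phi>"
    and "is_base \<Phi> alpha k"
    and "irreducible_rs \<Phi>"
    and "\<gamma> \<in> pos_roots \<Phi> alpha k"
    and "\<forall>\<alpha>\<in>\<Phi>. prec_eq \<Phi> alpha k \<alpha> \<gamma>"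
  shows "\<exists>(D :: nat \<Rightarrow> (('v \<Rightarrow> 'v) \<Rightarrow> rpoly) \<Rightarrow> (('v \<Rightarrow> 'v) \<Rightarrow> rpoly))
           (Pc :: ('v \<Rightarrow> 'v) \<Rightarrow> (('v \<Rightarrow> 'v) \<Rightarrow> rpoly)).
     (\<forall>i<k. module_hom \<Phi> alpha k \<gamma> (D i))
   \<and> (\<forall>w\<in>weyl alpha k. flow_up \<Phi> alpha k \<gamma> w (Pc w))
   \<and> (\<forall>w\<in>weyl alpha k. \<forall>i<k.
        (bruhat_less \<Phi> alpha k (refl (alpha i) \<circ> w) w \<longrightarrow> D i (Pc w) = Pc (refl (alpha i) \<circ> w))
      \<and> (bruhat_less \<Phi> alpha k w (refl (alpha i) \<circ> w) \<longrightarrow> D i (Pc w) = (\<lambda>_. 0)))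
   \<and> (\<forall>w\<in>weyl alpha k. \<forall>is js. reduced_expr alpha k is w \<and> reduced_expr alpha k js w \<longrightarrow>
        (\<forall>P\<in>GKM \<Phi> alpha k \<gamma>. op_word D is P = op_word D js P))"
proof -
  interpret highest_root \<Phi> alpha k \<gamma>
    using assms by unfold_locales auto
  obtain F where F: "\<And>w. w \<in> W \<Longrightarrow> flow_up \<Phi> alpha k \<gamma> w (F w)"
    using flow_up_exists by metis
  interpret flow_up_basis \<Phi> alpha k \<gamma> F
    by unfold_locales (rule F)
  \<comment> \<open>Bruhat order raises \<open>N\<close>, and the sign of
    \<open>inv w (alpha i)\<close> decides how \<open>N\<close> moves under the reflection; so the
    order hypothesis selects the branch of \<open>ddiff_F\<close>.\<close>
  have up: "ddiff i (F w) = (\<lambda>_. 0)"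
    if "w \<in> W" "i < k" "bruhat_less \<Phi> alpha k w (refl (alpha i) \<circ> w)" for i w
  proof -
    have "\<not> ht (inv w (alpha i)) < 0"
      using that(3) hless_N_less[of 0 w "refl (alpha i) \<circ> w"] N_simple_left'[OF that(1,2)]
      unfolding bruhat_less_eq by fastforce
    then show ?thesis using ddiff_F[OF that(1)] by simp
  qed
  have down: "ddiff i (F w) = F (refl (alpha i) \<circ> w)"
    if "w \<in> W" "i < k" "bruhat_less \<Phi> alpha k (refl (alpha i) \<circ> w) w" for i w
  proof -
    have "\<not> ht (inv w (alpha i)) > 0"
      using that(3) hless_N_less[of 0 "refl (alpha i) \<circ> w" w] N_simple_left[OF that(1,2)]
      unfolding bruhat_less_eq by fastforce
    moreover have "ht (inv w (alpha i)) \<noteq> 0"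
      using ht_root(1) weyl_inv_root[OF that(1)] alpha_root[OF that(2)] by blast
    ultimately have "ht (inv w (alpha i)) < 0" by linarith
    then show ?thesis using ddiff_F[OF that(1)] by simp
  qed
  show ?thesis
    by (intro exI[of _ ddiff] exI[of _ F] conjI ballI allI impI)
       (use module_hom_ddiff F up down op_word_reduced in blast)+
qed

end
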